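(* Let $G$ be a graph with $n$ nodes and an unknown girth $g < \log n$. There exists an $O(1)$-round algorithm in the Congested Clique model which either outputs $g$, or ensures that every node $v$ knows its $\lfloor g/20 \rfloor$ hop-neighborhood $N_{\lfloor g/20\rfloor}(v)$.
   Context: The girth is the length of a shortest cycle. For a node $v$ and integer $i$, $N_i(v)$ denotes the graph consisting of all nodes at hop-distance at most $i$ from $v$ together with all edges incident to nodes at hop-distance at most $i-1$ from $v$; knowing it means knowing its nodes and edges. Congested Clique model: the $n$ vertices of $G$ are synchronous processors; in each round every pair may exchange an $O(\log n)$-bit message; initially each node knows only its incident edges. *)

theory Defs
  imports Complex_Main "HOL-Library.Extended_Nat"
begin

section \<open>Simple graphs, girth and hop-neighborhoods\<close>

record 'a graph =
  verts :: "'a set"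
  edges :: "'a set set"

definition simple_graph :: "'a graph \<Rightarrow> bool" where
  "simple_graph G \<longleftrightarrow> finite (verts G) \<and> (\<forall>e\<in>edges G. e \<subseteq> verts G \<and> card e = 2)"

definition subgraph :: "'a graph \<Rightarrow> 'a graph \<Rightarrow> bool" where
  "subgraph H G \<longleftrightarrow> verts H \<subseteq> verts G \<and> edges H \<subseteq> edges G"

definition walk :: "'a graph \<Rightarrow> 'a list \<Rightarrow> bool" where
  "walk G p \<longleftrightarrow> p \<noteq> [] \<and> set p \<subseteq> verts G \<and> successively (\<lambda>x y. {x, y} \<in> edges G) p"

text \<open>A cycle is listed without repeating its first vertex, so its length is the length
  of the list.\<close>

definition cycle :: "'a graph \<Rightarrow> 'a list \<Rightarrow> bool" where
  "cycle G p \<longleftrightarrow> walk G p \<and> distinct p \<and> 3 \<le> length p \<and> {last p, hd p} \<in> edges G"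

text \<open>The girth of a forest is \<open>\<infinity>\<close>, and so is the distance between two vertices in different
  components.\<close>

definition girth :: "'a graph \<Rightarrow> enat" where
  "girth G = (INF p\<in>{p. cycle G p}. enat (length p))"

definition hop_dist :: "'a graph \<Rightarrow> 'a \<Rightarrow> 'a \<Rightarrow> enat" where
  "hop_dist G u v = (INF p\<in>{p. walk G p \<and> hd p = u \<and> last p = v}. enat (length p - 1))"

text \<open>The edge condition is written with \<open>+ 1\<close> because for \<open>i = 0\<close> no vertex is at distance at
  most \<open>i - 1\<close>, so that the neighborhood of radius \<open>0\<close> has no edges.\<close>

definition nbhd :: "'a graph \<Rightarrow> nat \<Rightarrow> 'a \<Rightarrow> 'a graph" where
  "nbhd G i v =
    \<lparr>verts = {u \<in> verts G. hop_dist G v u \<le> enat i},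
     edges = {e \<in> edges G. \<exists>u\<in>e. hop_dist G v u + 1 \<le> enat i}\<rparr>"


section \<open>The Congested Clique\<close>

text \<open>Local computation is unrestricted and deterministic, so the state of a node is taken to be
  everything it has seen: the number of nodes, its own identifier, its incident edges, and for each
  past round the message received from every node. A protocol consists of two functions of this
  view: the message for a given recipient, and the final result.\<close>

record local_view =
  network_size :: nat
  node_id :: nat
  incident_edges :: "nat set set"
  inboxes :: "(nat \<Rightarrow> bool list) list"

record 'r protocol =
  message :: "local_view \<Rightarrow> nat \<Rightarrow> bool list"
  result :: "local_view \<Rightarrow> 'r"

primrec view :: "'r protocol \<Rightarrow> nat graph \<Rightarrow> nat \<Rightarrow> nat \<Rightarrow> local_view" where
  "view A G 0 v =
    \<lparr>network_size = card (verts G), node_id = v,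
     incident_edges = {e \<in> edges G. v \<in> e}, inboxes = []\<rparr>"
| "view A G (Suc t) v =
    (view A G t v)\<lparr>inboxes := inboxes (view A G t v) @
       [\<lambda>u. if u \<in> verts G - {v} then message A (view A G t u) v else []]\<rparr>"

definition result_after :: "'r protocol \<Rightarrow> nat \<Rightarrow> nat graph \<Rightarrow> nat \<Rightarrow> 'r" where
  "result_after A R G v = result A (view A G R v)"

text \<open>Messages have at most \<open>c log n\<close> bits; \<open>c\<close> is the constant hidden in \<open>O(log n)\<close>.\<close>

definition bandwidth :: "nat \<Rightarrow> 'r protocol \<Rightarrow> bool" where
  "bandwidth c A \<longleftrightarrow>
    (\<forall>s w. real (length (message A s w)) \<le> real c * log 2 (real (network_size s)))"

text \<open>A node returns either a value for the girth or the subgraph that it has learned.\<close>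

datatype girth_result = Girth_Is nat | Known_Subgraph "nat graph"

text \<open>A node knows \<open>H\<close> if the subgraph it returns contains only vertices and edges that are really
  present in \<open>G\<close> and contains all those of \<open>H\<close>.\<close>

definition knows :: "nat graph \<Rightarrow> girth_result \<Rightarrow> nat graph \<Rightarrow> bool" where
  "knows G r H \<longleftrightarrow> (\<exists>K. r = Known_Subgraph K \<and> subgraph H K \<and> subgraph K G)"


subsection \<open>Knowing a neighborhood determines it\<close>

lemma hop_dist_le_iff:
  "hop_dist G u v \<le> enat k \<longleftrightarrow> (\<exists>p. walk G p \<and> hd p = u \<and> last p = v \<and> length p \<le> Suc k)"
proof
  let ?P = "{p. walk G p \<and> hd p = u \<and> last p = v}"
  assume le: "hop_dist G u v \<le> enat k"
  have "?P \<noteq> {}"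
  proof
    assume "?P = {}"
    then have "hop_dist G u v = \<infinity>"
      unfolding hop_dist_def by (simp only: image_empty Inf_enat_def) simp
    with le show False by simp
  qed
  then have "(INF p\<in>?P. enat (length p - 1)) \<in> (\<lambda>p. enat (length p - 1)) ` ?P"
    by (simp only: Inf_enat_def image_is_empty if_False) (rule LeastI_ex, blast)
  then have "hop_dist G u v \<in> (\<lambda>p. enat (length p - 1)) ` ?P"
    unfolding hop_dist_def .
  then obtain p where "p \<in> ?P" "hop_dist G u v = enat (length p - 1)" by auto
  with le show "\<exists>p. walk G p \<and> hd p = u \<and> last p = v \<and> length p \<le> Suc k" by auto
next
  assume "\<exists>p. walk G p \<and> hd p = u \<and> last p = v \<and> length p \<le> Suc k"
  then obtain p where p: "walk G p" "hd p = u" "last p = v" "length p \<le> Suc k" by blast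
  have "hop_dist G u v \<le> enat (length p - 1)"
    unfolding hop_dist_def using p by (intro INF_lower) auto
  also have "\<dots> \<le> enat k" using p(4) by simp
  finally show "hop_dist G u v \<le> enat k" .
qed

lemma hop_dist_subgraph_le:
  assumes "subgraph K G" "hop_dist K u v \<le> enat k"
  shows "hop_dist G u v \<le> enat k"
proof -
  obtain p where p: "walk K p" "hd p = u" "last p = v" "length p \<le> Suc k"
    using assms(2) unfolding hop_dist_le_iff by blast
  have "walk G p"
    using p(1) assms(1) unfolding walk_def subgraph_def
    by (metis (no_types, lifting) subset_trans subsetD successively_mono)
  with p show ?thesis unfolding hop_dist_le_iff by blast
qed

lemma plus_one_le_enat_iff: "a + 1 \<le> enat i \<longleftrightarrow> (\<exists>j. i = Suc j \<and> a \<le> enat j)"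
  by (cases a; cases i) (auto simp: one_enat_def zero_enat_def)

lemma walk_in_nbhd:
  assumes "walk G p" "hd p = v" "length p \<le> Suc i" "subgraph (nbhd G i v) K"
  shows "walk K p"
proof -
  have "length p \<le> Suc i \<Longrightarrow> walk G p \<Longrightarrow> hd p = v \<Longrightarrow> walk K p"
  proof (induction p rule: rev_induct)
    case Nil
    then show ?case by (simp add: walk_def)
  next
    case (snoc x q)
    have "hop_dist G v x \<le> enat i"
      using snoc.prems unfolding hop_dist_le_iff by (intro exI[of _ "q @ [x]"]) simp
    then have x: "x \<in> verts K"
      using assms(4) snoc.prems(2) by (auto simp: nbhd_def subgraph_def walk_def)
    show ?case
    proof (cases "q = []")
      case True
      with x show ?thesis by (simp add: walk_def)
    next
      case False
      have wq: "walk G q" and e: "{last q, x} \<in> edges G" and h: "hd q = v"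
        using snoc.prems(2,3) False by (auto simp: walk_def successively_append_iff)
      from False snoc.prems(1) obtain j where j: "i = Suc j" "length q \<le> Suc j"
        by (cases i) auto
      have "hop_dist G v (last q) \<le> enat j"
        using wq h j(2) unfolding hop_dist_le_iff by blast
      then have "hop_dist G v (last q) + 1 \<le> enat i"
        using j(1) unfolding plus_one_le_enat_iff by blast
      then have "{last q, x} \<in> edges K"
        using e assms(4) by (auto simp: nbhd_def subgraph_def)
      moreover have "walk K q" using snoc.IH wq h j by simp
      ultimately show ?thesis
        using x False by (auto simp: walk_def successively_append_iff)
    qed
  qed
  then show ?thesis using assms(1-3) by simp
qed

text \<open>The returned subgraph may be larger than the neighborhood, since a node need not know the
  radius; once the radius is given, the neighborhood can be read off from it.\<close>

lemma nbhd_eq_if_between: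
  assumes "subgraph (nbhd G i v) K" "subgraph K G"
  shows "nbhd K i v = nbhd G i v"
proof -
  have d: "hop_dist K v u \<le> enat j \<longleftrightarrow> hop_dist G v u \<le> enat j" if "j \<le> i" for u j
  proof
    assume "hop_dist G v u \<le> enat j"
    then obtain p where p: "walk G p" "hd p = v" "last p = u" "length p \<le> Suc j"
      unfolding hop_dist_le_iff by blast
    have "length p \<le> Suc i" using p(4) that by simp
    from walk_in_nbhd[OF p(1,2) this assms(1)] have "walk K p" .
    with p show "hop_dist K v u \<le> enat j" unfolding hop_dist_le_iff by blast
  qed (rule hop_dist_subgraph_le[OF assms(2)])
  have d1: "hop_dist K v u + 1 \<le> enat i \<longleftrightarrow> hop_dist G v u + 1 \<le> enat i" for u
    unfolding plus_one_le_enat_iff using d by (metis Suc_leD order_refl)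
  have "verts (nbhd K i v) = verts (nbhd G i v)"
    using assms d[of i] by (auto simp: nbhd_def subgraph_def)
  moreover have "edges (nbhd K i v) = edges (nbhd G i v)"
    using assms d1 by (auto simp: nbhd_def subgraph_def)
  ultimately show ?thesis by simp
qed

end

theory Submission
  imports Defs "HOL-Library.Disjoint_Sets"
begin

text \<open>Let \<open>n\<close> be the number of vertices and \<open>r = g div 20\<close>. By the Moore bound all subgraphs have
  average degree \<open>O(D)\<close>, where \<open>D\<close> is about \<open>n powr (1 / (9 * r))\<close>. Hence, for a suitable threshold \<open>t\<close>
  with \<open>t\<^sup>2 = O(D ^ 3)\<close>, discarding twice all vertices of degree at most \<open>t\<close> leaves \<open>O(n)\<close> edges, which
  everybody can learn; every other edge is owned by an endpoint that owns at most \<open>t\<close> edges. Split the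
  vertices into \<open>6 * \<rho> * t\<close> parts. A set of \<open>O(\<rho>)\<close> parts owns \<open>O(n)\<close> edges, so one node can learn
  them, and there are at most \<open>n\<close> sets of at most \<open>6 * \<rho>\<close> parts as long as \<open>(18 * t) ^ (6 * \<rho>) \<le> n\<close>,
  which holds for \<open>\<rho> = r\<close>. All nodes can compute the largest suitable \<open>\<rho>\<close>, although \<open>r\<close> is unknown.

  A cycle of length at most \<open>6 * \<rho>\<close> is seen by the node in charge of the parts of its owners. If there
  is none, all balls of radius \<open>3 * \<rho>\<close> are trees. For every set \<open>Q\<close> of at most \<open>\<rho>\<close> parts, the nodes
  in charge of \<open>Q\<close> tell \<open>x\<close> the paths from \<open>x\<close> of length at most \<open>\<rho>\<close> whose owners lie exactly in the
  parts \<open>Q\<close>, one path per node. Where there are too many of these paths, the ball of \<open>x\<close> is large; but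
  there is room for only a few disjoint large balls, so such an \<open>x\<close> is at distance at most \<open>2 * \<rho>\<close>
  from one of a few centers. For each center there are enough nodes to find its ball of radius
  \<open>3 * \<rho>\<close>, and \<open>x\<close> fetches the edges of that ball from these nodes.\<close>

section \<open>Functions computable in a constant number of rounds\<close>

lemma view_components [simp]:
  "network_size (view A G t v) = card (verts G)" "node_id (view A G t v) = v"
  "incident_edges (view A G t v) = {e \<in> edges G. v \<in> e}" "length (inboxes (view A G t v)) = t"
  by (induction t) auto

text \<open>The number of inboxes in a view counts the rounds passed, so protocols that agree on
  shorter histories give the same views. This lets a protocol be prolonged without disturbing its
  first \<open>t\<close> rounds.\<close>

lemma view_cong:
  assumes "\<And>s w. length (inboxes s) < t \<Longrightarrow> message A s w = message B s w"
  shows "view A G t v = view B G t v"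
proof -
  have "i \<le> t \<Longrightarrow> view A G i v = view B G i v" for i v
  proof (induction i arbitrary: v)
    case (Suc i)
    then have "view A G i u = view B G i u" for u by simp
    moreover have "message A (view B G i u) w = message B (view B G i u) w" for u w
      by (rule assms) (use Suc in simp)
    ultimately show ?case by (simp cong: if_cong)
  qed simp
  then show ?thesis by simp
qed

text \<open>Protocol, bandwidth constant and number of rounds are chosen before the graph, so this
  is computability in \<open>O(1)\<close> rounds on the class. The value belongs to the node
  \<open>v\<close> and may itself be a function.\<close>

definition learnable :: "nat graph set \<Rightarrow> (nat graph \<Rightarrow> nat \<Rightarrow> 'a) \<Rightarrow> bool" where
  "learnable \<G> f \<longleftrightarrow> (\<exists>(A :: 'a protocol) c R. bandwidth c A \<and>
     (\<forall>G\<in>\<G>. \<forall>v\<in>verts G. result_after A R G v = f G v))"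

text \<open>Local computation is free, as long as \<open>h\<close> does not depend on the
  graph.\<close>

lemma learnable_map:
  assumes "learnable \<G> f" "\<And>G v. G \<in> \<G> \<Longrightarrow> v \<in> verts G \<Longrightarrow> f' G v = h (f G v)"
  shows "learnable \<G> f'"
proof -
  obtain A c R where A: "bandwidth c A" "\<forall>G\<in>\<G>. \<forall>v\<in>verts G. result_after A R G v = f G v"
    using assms(1) unfolding learnable_def by blast
  let ?B = "\<lparr>message = message A, result = h \<circ> result A\<rparr>"
  have "view ?B G R v = view A G R v" for G v by (rule view_cong) simp
  with A assms(2) show ?thesis
    unfolding learnable_def
    by (intro exI[of _ ?B] exI[of _ c] exI[of _ R]) (auto simp: bandwidth_def result_after_def)
qed

lemma learnable_mono: "learnable \<G> f \<Longrightarrow> \<H> \<subseteq> \<G> \<Longrightarrow> learnable \<H> f"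
  unfolding learnable_def by blast

text \<open>Outside the class the protocol still returns something. It can thus be run on every
  input, and its result discarded afterwards where it is meaningless.\<close>

lemma learnable_extend:
  assumes "learnable \<H> f"
  shows "\<exists>f'. learnable UNIV f' \<and> (\<forall>G\<in>\<H>. \<forall>v\<in>verts G. f' G v = f G v)"
  using assms unfolding learnable_def by blast

lemma learnable_local:
  "learnable \<G> (\<lambda>G v. (card (verts G), v, {e \<in> edges G. v \<in> e}))"
proof -
  let ?A = "\<lparr>message = \<lambda>_ _. [], result = \<lambda>s. (network_size s, node_id s, incident_edges s)\<rparr>"
  have "bandwidth 0 ?A" by (simp add: bandwidth_def)
  then show ?thesis
    unfolding learnable_def
    by (intro exI[of _ ?A] exI[of _ 0]) (auto simp: result_after_def)
qed

lemma bandwidth_mono: "bandwidth c A \<Longrightarrow> c \<le> d \<Longrightarrow> bandwidth d A"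
  unfolding bandwidth_def
proof (intro allI)
  fix s :: local_view and w
  assume a: "\<forall>s w. real (length (message A s w)) \<le> real c * log 2 (real (network_size s))" "c \<le> d"
  have "0 \<le> log 2 (real (network_size s))"
    by (cases "network_size s") (auto simp: log_def)
  with a(2) have "real c * log 2 (real (network_size s)) \<le> real d * log 2 (real (network_size s))"
    by (intro mult_right_mono) auto
  with a(1) show "real (length (message A s w)) \<le> real d * log 2 (real (network_size s))"
    by (meson order_trans)
qed

text \<open>The protocols run one after the other. The second is shown the view without the first
  \<open>R\<close> inboxes, which is the view of a fresh start.\<close>

lemma learnable_pair:
  assumes "learnable \<G> f" "learnable \<G> f'"
  shows "learnable \<G> (\<lambda>G v. (f G v, f' G v))"
proof -
  obtain A c R where A: "bandwidth c A" "\<forall>G\<in>\<G>. \<forall>v\<in>verts G. result_after A R G v = f G v"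
    using assms(1) unfolding learnable_def by blast
  obtain B d S where B: "bandwidth d B" "\<forall>G\<in>\<G>. \<forall>v\<in>verts G. result_after B S G v = f' G v"
    using assms(2) unfolding learnable_def by blast
  define fst_part where "fst_part s = s\<lparr>inboxes := take R (inboxes s)\<rparr>" for s :: local_view
  define snd_part where "snd_part s = s\<lparr>inboxes := drop R (inboxes s)\<rparr>" for s :: local_view
  define P where "P = \<lparr>message = \<lambda>s w. if length (inboxes s) < R then message A s w
       else message B (snd_part s) w, result = \<lambda>s. (result A (fst_part s), result B (snd_part s))\<rparr>"
  have bw: "bandwidth (max c d) P"
    unfolding bandwidth_def
  proof (intro allI)
    fix s :: local_view and w
    have "real (length (message A s w)) \<le> real (max c d) * log 2 (real (network_size s))"
      using bandwidth_mono[OF A(1), of "max c d"] unfolding bandwidth_def by simp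
    moreover have "real (length (message B (snd_part s) w))
        \<le> real (max c d) * log 2 (real (network_size (snd_part s)))"
      using bandwidth_mono[OF B(1), of "max c d"] unfolding bandwidth_def by simp
    moreover have "network_size (snd_part s) = network_size s" by (simp add: snd_part_def)
    ultimately show "real (length (message P s w)) \<le> real (max c d) * log 2 (real (network_size s))"
      by (simp add: P_def)
  qed
  have vA: "view P G R v = view A G R v" for G v
    by (rule view_cong) (simp add: P_def)
  have v: "view P G (R + t) v
      = (view B G t v)\<lparr>inboxes := inboxes (view A G R v) @ inboxes (view B G t v)\<rparr>" for G t v
  proof (induction t arbitrary: v)
    case 0
    show ?case by (rule local_view.equality) (simp_all add: vA)
  next
    case (Suc t)
    have "snd_part (view P G (R + t) u) = view B G t u" for u
      by (simp add: snd_part_def Suc)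
    then have "message P (view P G (R + t) u) w = message B (view B G t u) w" for u w
      by (simp add: P_def)
    with Suc show ?case by (simp cong: if_cong)
  qed
  have "snd_part (view P G (R + S) v) = view B G S v" for G v
    by (simp add: snd_part_def v)
  moreover have "fst_part (view P G (R + S) v) = view A G R v" for G v
    by (rule local_view.equality) (simp_all add: fst_part_def v)
  ultimately have "result_after P (R + S) G v = (result_after A R G v, result_after B S G v)" for G v
    by (simp add: result_after_def P_def)
  with bw A(2) B(2) show ?thesis
    unfolding learnable_def by (intro exI[of _ P] exI[of _ "max c d"] exI[of _ "R + S"]) simp
qed

section \<open>Exchanging numbers of polynomial size in one round\<close>

definition word_length :: "nat \<Rightarrow> nat" where
  "word_length n = nat \<lceil>log 2 (real n)\<rceil>"

lemma word_length_le: "real (word_length n) \<le> 2 * log 2 (real n)"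
proof (cases "n \<le> 1")
  case True
  then have "n = 0 \<or> n = 1" by auto
  then show ?thesis by (auto simp: word_length_def log_def)
next
  case False
  then have "1 \<le> log 2 (real n)" by simp
  then show ?thesis unfolding word_length_def by linarith
qed

lemma le_two_power_word_length: "n \<le> 2 ^ word_length n"
proof (cases "n = 0")
  case False
  have "real n = 2 powr (log 2 (real n))" using False by simp
  also have "\<dots> \<le> 2 powr (real (word_length n))"
    unfolding word_length_def by (intro powr_mono) linarith+
  also have "\<dots> = 2 ^ word_length n" by (simp add: powr_realpow)
  finally have "real n \<le> real (2 ^ word_length n)" by simp
  then show ?thesis by (simp only: of_nat_le_iff)
qed simp

text \<open>After computing its value, \<open>u\<close> sends \<open>f G u v\<close> to
  \<open>v\<close> in one extra round. Numbers below \<open>n ^ k\<close> fit into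
  \<open>k * word_length n\<close> bits, which is \<open>O(log n)\<close>.\<close>

lemma learnable_transpose:
  assumes "learnable \<G> f"
    and bound: "\<And>G u v. G \<in> \<G> \<Longrightarrow> u \<in> verts G \<Longrightarrow> v \<in> verts G \<Longrightarrow> f G u v < card (verts G) ^ k"
  shows "learnable \<G> (\<lambda>G v u. if u \<in> verts G then f G u v else 0)"
proof -
  obtain A c R where A: "bandwidth c A" "\<forall>G\<in>\<G>. \<forall>v\<in>verts G. result_after A R G v = f G v"
    using assms(1) unfolding learnable_def by blast
  define L where "L n = k * word_length n" for n
  \<comment> \<open>No node receives a message from itself, so the entry for its own identifier is
    recomputed from its view before the last round.\<close>
  define P where "P = \<lparr>message = \<lambda>s w. if length (inboxes s) < R then message A s w
       else map (bit (result A s w)) [0..<L (network_size s)],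
       result = \<lambda>s u. if u = node_id s
         then result A (s\<lparr>inboxes := take R (inboxes s)\<rparr>) (node_id s)
         else horner_sum of_bool 2 (last (inboxes s) u) :: nat\<rparr>"
  have L: "real (L n) \<le> real (2 * k) * log 2 (real n)" for n
    using mult_left_mono[OF word_length_le[of n], of "real k"] by (simp add: L_def)
  have bw: "bandwidth (max c (2 * k)) P"
    unfolding bandwidth_def
  proof (intro allI)
    fix s :: local_view and w
    have "0 \<le> log 2 (real (network_size s))"
      using word_length_le[of "network_size s"] by linarith
    then have "real (2 * k) * log 2 (real (network_size s))
        \<le> real (max c (2 * k)) * log 2 (real (network_size s))"
      by (intro mult_right_mono) auto
    with L[of "network_size s"] bandwidth_mono[OF A(1), of "max c (2 * k)"]
    show "real (length (message P s w)) \<le> real (max c (2 * k)) * log 2 (real (network_size s))"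
      by (auto simp: P_def bandwidth_def)
  qed
  have vA: "view P G R v = view A G R v" for G v
    by (rule view_cong) (simp add: P_def)
  have "result_after P (Suc R) G v u = (if u \<in> verts G then f G u v else 0)"
    if G: "G \<in> \<G>" and v: "v \<in> verts G" for G v u
  proof -
    let ?s = "view P G (Suc R) v"
    consider "u = v" | "u \<noteq> v" "u \<in> verts G" | "u \<notin> verts G" using v by blast
    then show ?thesis
    proof cases
      case 1
      have "?s\<lparr>inboxes := take R (inboxes ?s)\<rparr> = view A G R v"
        by (rule local_view.equality) (simp_all add: vA)
      then show ?thesis using A(2) G v 1
        by (simp add: result_after_def P_def)
    next
      case 2
      have "f G u v < 2 ^ L (card (verts G))"
      proof -
        have "f G u v < card (verts G) ^ k" using bound G v 2 by blast
        also have "\<dots> \<le> (2 ^ word_length (card (verts G))) ^ k"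
          by (intro power_mono le_two_power_word_length) simp
        finally show ?thesis by (simp add: L_def mult.commute flip: power_mult)
      qed
      moreover have "message P (view A G R u) v = map (bit (f G u v)) [0..<L (card (verts G))]"
        using A(2) G 2 by (simp add: P_def result_after_def)
      then have "last (inboxes ?s) u = map (bit (f G u v)) [0..<L (card (verts G))]"
        using 2 by (simp add: vA)
      ultimately show ?thesis using 2
        by (simp add: result_after_def P_def horner_sum_bit_eq_take_bit take_bit_nat_eq_self
            del: view.simps)
    next
      case 3
      \<comment> \<open>The empty message decodes to \<open>0\<close>, which is why \<open>0\<close>
        is the default value in the statement.\<close>
      then have "last (inboxes ?s) u = []" by simp
      with 3 v show ?thesis by (auto simp: result_after_def P_def simp del: view.simps)
    qed
  qed
  with bw show ?thesis
    unfolding learnable_def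
    by (intro exI[of _ P] exI[of _ "max c (2 * k)"] exI[of _ "Suc R"]) (auto simp: fun_eq_iff)
qed

lemma learnable_broadcast:
  assumes "learnable \<G> f" "\<And>G u. G \<in> \<G> \<Longrightarrow> u \<in> verts G \<Longrightarrow> f G u < card (verts G) ^ k"
  shows "learnable \<G> (\<lambda>G v u. if u \<in> verts G then f G u else 0)"
proof (rule learnable_transpose)
  show "learnable \<G> (\<lambda>G u v. f G u)"
    by (rule learnable_map[OF assms(1), where h = "\<lambda>x v. x"]) simp
qed (rule assms(2))

text \<open>\<open>C\<close> does not depend on the graph, so running the protocols in turn takes
  \<open>O(1)\<close> rounds.\<close>

lemma learnable_family:
  fixes C :: nat
  assumes "\<And>i. i < C \<Longrightarrow> learnable \<G> (f i)"
  shows "learnable \<G> (\<lambda>G v i. if i < C then f i G v else undefined)"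
  using assms
proof (induction C)
  case 0
  show ?case by (rule learnable_map[OF learnable_local, where h = "\<lambda>_ _. undefined"]) simp
next
  case (Suc C)
  have "learnable \<G> (\<lambda>G v. ((\<lambda>i. if i < C then f i G v else undefined), f C G v))"
    using Suc by (intro learnable_pair) auto
  then show ?case
    by (rule learnable_map[where h = "\<lambda>(F, x) i. if i = C then x else F i"])
      (auto simp: fun_eq_iff less_Suc_eq)
qed

section \<open>Fetching data from other nodes\<close>

definition inputs :: "nat graph set" where
  "inputs = {G. simple_graph G \<and> verts G = {..<card (verts G)} \<and> 2 \<le> card (verts G)}"

definition interval_start :: "nat set \<Rightarrow> (nat \<Rightarrow> nat) \<Rightarrow> nat \<Rightarrow> nat" where
  "interval_start S d u = (\<Sum>w\<in>{w \<in> S. w < u}. d w)"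

text \<open>The requested words are numbered consecutively, the blocks of the sources following the
  order of identifiers. Positions behind the last block go to \<open>0\<close>, which is always a
  valid identifier to send.\<close>

definition interval_owner :: "nat set \<Rightarrow> (nat \<Rightarrow> nat) \<Rightarrow> nat \<Rightarrow> nat" where
  "interval_owner S d i =
    (let P = \<lambda>u. u \<in> S \<and> interval_start S d u \<le> i \<and> i < interval_start S d u + d u
     in if \<exists>u. P u then SOME u. P u else 0)"

lemma interval_end_le:
  assumes "finite S" "u \<in> S" "u < w"
  shows "interval_start S d u + d u \<le> interval_start S d w"
proof -
  have "interval_start S d u + d u = (\<Sum>w\<in>insert u {w \<in> S. w < u}. d w)"
    unfolding interval_start_def using assms by (subst sum.insert) auto
  also have "\<dots> \<le> interval_start S d w"
    unfolding interval_start_def using assms by (intro sum_mono2) auto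
  finally show ?thesis .
qed

lemma interval_end_le_total:
  assumes "finite S" "u \<in> S"
  shows "interval_start S d u + d u \<le> (\<Sum>w\<in>S. d w)"
proof -
  have "interval_start S d u + d u = (\<Sum>w\<in>insert u {w \<in> S. w < u}. d w)"
    unfolding interval_start_def using assms by (subst sum.insert) auto
  also have "\<dots> \<le> (\<Sum>w\<in>S. d w)"
    using assms by (intro sum_mono2) auto
  finally show ?thesis .
qed

lemma interval_owner_eq:
  assumes "finite S" "u \<in> S" "interval_start S d u \<le> i" "i < interval_start S d u + d u"
  shows "interval_owner S d i = u"
proof -
  let ?P = "\<lambda>u. u \<in> S \<and> interval_start S d u \<le> i \<and> i < interval_start S d u + d u"
  have u: "?P u" using assms by blast
  have "w = u" if w: "?P w" for w
  proof (cases u w rule: linorder_cases)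
    case less
    with interval_end_le[OF assms(1,2) less, of d] u w show ?thesis by linarith
  next
    case greater
    then have "interval_start S d w + d w \<le> interval_start S d u"
      using interval_end_le[OF assms(1)] w by blast
    with u w show ?thesis by linarith
  qed simp
  then have "(SOME u. ?P u) = u" using u by (intro some_equality)
  then show ?thesis
    unfolding interval_owner_def Let_def using u by (subst if_P) blast+
qed

lemma interval_owner_less:
  assumes "S \<subseteq> {..<n}" "0 < n"
  shows "interval_owner S d i < n"
proof (cases "\<exists>u. u \<in> S \<and> interval_start S d u \<le> i \<and> i < interval_start S d u + d u")
  case True
  from someI_ex[OF True] assms(1) show ?thesis
    unfolding interval_owner_def Let_def using True by auto
next
  case False
  then show ?thesis unfolding interval_owner_def Let_def using assms(2) by (subst if_not_P) auto
qed

text \<open>For \<open>i < d\<close>, this is the least number from \<open>s\<close> on that is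
  congruent to \<open>i\<close> modulo \<open>d\<close>.\<close>

definition slot :: "nat \<Rightarrow> nat \<Rightarrow> nat \<Rightarrow> nat" where
  "slot s d i = s + (i + d - s mod d) mod d"

lemma slot:
  assumes "i < d"
  shows "s \<le> slot s d i" "slot s d i < s + d" "slot s d i mod d = i"
proof -
  have "(s + (i + d - s mod d) mod d) mod d = (s mod d + (i + d - s mod d)) mod d"
    by (simp add: mod_simps)
  also have "s mod d + (i + d - s mod d) = i + d"
    using assms by (simp add: less_imp_le trans_le_add2)
  finally show "slot s d i mod d = i" using assms by (simp add: slot_def)
qed (use assms in \<open>auto simp: slot_def\<close>)

text \<open>Every node \<open>v\<close> may request the data of a set of nodes, as long as their total length is
  \<open>O(n)\<close>. To a requested node \<open>u\<close> with \<open>d\<close> words, \<open>v\<close> assigns \<open>d\<close> consecutive helpers. Helper \<open>x\<close>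
  has received the word with index \<open>x mod d\<close> from \<open>u\<close>, for all \<open>u\<close>, whatever the requests are; since
  \<open>d\<close> consecutive numbers meet all residues modulo \<open>d\<close>, the helpers assigned to \<open>u\<close> have all of its
  words. If \<open>v\<close> requests more than \<open>n\<close> words, each helper \<open>x < n\<close> stands for \<open>x\<close>, \<open>n + x\<close>, \<open>2n + x\<close>, and
  so on.\<close>

lemma learnable_fetch:
  fixes data :: "nat graph \<Rightarrow> nat \<Rightarrow> nat list" and req :: "nat graph \<Rightarrow> nat \<Rightarrow> nat set" and C :: nat
  assumes inputs: "\<G> \<subseteq> inputs"
    and data: "learnable \<G> data" and req: "learnable \<G> req"
    and len: "\<And>G u. G \<in> \<G> \<Longrightarrow> u \<in> verts G \<Longrightarrow> length (data G u) < card (verts G) ^ k"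
    and words: "\<And>G u w. G \<in> \<G> \<Longrightarrow> u \<in> verts G \<Longrightarrow> w \<in> set (data G u) \<Longrightarrow> w < card (verts G) ^ k"
    and req_sub: "\<And>G v. G \<in> \<G> \<Longrightarrow> v \<in> verts G \<Longrightarrow> req G v \<subseteq> verts G"
    and total: "\<And>G v. G \<in> \<G> \<Longrightarrow> v \<in> verts G \<Longrightarrow>
      (\<Sum>u\<in>req G v. length (data G u)) \<le> C * card (verts G)"
  shows "learnable \<G> (\<lambda>G v u. if u \<in> req G v then data G u else [])"
proof -
  let ?n = "\<lambda>G :: nat graph. card (verts G)"
  have V: "verts G = {..<?n G}" "0 < ?n G" if "G \<in> \<G>" for G
    using that inputs unfolding inputs_def by auto
  define d where "d G u = (if u \<in> verts G then length (data G u) else 0)" for G u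
  have d: "learnable \<G> (\<lambda>G v. d G)"
  proof -
    have "learnable \<G> (\<lambda>G u. length (data G u))"
      by (rule learnable_map[OF data]) simp
    from learnable_broadcast[OF this len]
    have "learnable \<G> (\<lambda>G v u. if u \<in> verts G then length (data G u) else 0)" .
    then show ?thesis by (rule learnable_map[where h = "\<lambda>x. x"]) (auto simp: d_def)
  qed
  \<comment> \<open>Three transposes for each \<open>\<rho> < C\<close>, in which \<open>x\<close>
    acts as position \<open>\<rho> * n + x\<close>: every \<open>u\<close> deposits one of its words
    at \<open>x\<close>, \<open>v\<close> names to \<open>x\<close> the source whose word it wants,
    and \<open>x\<close> sends that word to \<open>v\<close>.\<close>
  define stored where "stored \<rho> G x u = (if u \<in> verts G then
      (if data G u = [] then 0 else data G u ! ((\<rho> * ?n G + x) mod length (data G u))) else 0)"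
    for \<rho> G x u
  define ask where "ask \<rho> G x v = (if v \<in> verts G then
      interval_owner (req G v) (d G) (\<rho> * ?n G + x) else 0)" for \<rho> G x v
  define reply where "reply \<rho> G v x = (if x \<in> verts G then stored \<rho> G x (ask \<rho> G x v) else 0)"
    for \<rho> G v x
  have stored: "learnable \<G> (stored \<rho>)" for \<rho>
  proof -
    have "learnable \<G> (\<lambda>G u x. if data G u = [] then 0
        else data G u ! ((\<rho> * ?n G + x) mod length (data G u)))"
      by (rule learnable_map[OF learnable_pair[OF data learnable_local], where h =
        "\<lambda>(D, n, _) x. if D = [] then 0 else D ! ((\<rho> * n + x) mod length D)"]) simp
    then show ?thesis unfolding stored_def[abs_def]
      by (rule learnable_transpose[where k = k]) (auto simp: V(2) intro!: words[OF _ _ nth_mem])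
  qed
  have ask: "learnable \<G> (ask \<rho>)" for \<rho>
  proof -
    have "learnable \<G> (\<lambda>G v x. interval_owner (req G v) (d G) (\<rho> * ?n G + x))"
      by (rule learnable_map[OF learnable_pair[OF learnable_pair[OF req d] learnable_local],
        where h = "\<lambda>((S, e), n, _) x. interval_owner S e (\<rho> * n + x)"]) simp
    then show ?thesis unfolding ask_def[abs_def]
    proof (rule learnable_transpose[where k = 1])
      fix G u v assume "G \<in> \<G>" "u \<in> verts G"
      then show "interval_owner (req G u) (d G) (\<rho> * ?n G + v) < ?n G ^ 1"
        using req_sub V interval_owner_less[of "req G u" "?n G"] by simp
    qed
  qed
  have reply: "learnable \<G> (reply \<rho>)" for \<rho>
  proof -
    have "learnable \<G> (\<lambda>G x v. stored \<rho> G x (ask \<rho> G x v))"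
      by (rule learnable_map[OF learnable_pair[OF stored ask], where h = "\<lambda>(s, a) v. s (a v)"]) simp
    then show ?thesis unfolding reply_def[abs_def]
      by (rule learnable_transpose[where k = k])
        (auto simp: stored_def V(2) intro!: words[OF _ _ nth_mem])
  qed
  have "learnable \<G> (\<lambda>G v \<rho>. if \<rho> < C then reply \<rho> G v else undefined)"
    by (rule learnable_family) (rule reply)
  from learnable_pair[OF learnable_pair[OF this learnable_pair[OF req d]] learnable_local]
  show ?thesis
  proof (rule learnable_map[where h = "\<lambda>((F, S, e), n, _) u. if u \<in> S then
      map (\<lambda>i. let p = slot (interval_start S e u) (e u) i in F (p div n) (p mod n)) [0..<e u] else []"])
    fix G v assume G: "G \<in> \<G>" "v \<in> verts G"
    let ?S = "req G v"
    have fin: "finite ?S" using V[OF G(1)] req_sub[OF G] by (metis finite_lessThan finite_subset)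
    have "(let p = slot (interval_start ?S (d G) u) (d G u) i in
        (if p div ?n G < C then reply (p div ?n G) G v else undefined) (p mod ?n G)) = data G u ! i"
      if u: "u \<in> ?S" and i: "i < d G u" for u i
    proof -
      let ?p = "slot (interval_start ?S (d G) u) (d G u) i"
      have uV: "u \<in> verts G" using u req_sub[OF G] by blast
      have p: "interval_start ?S (d G) u \<le> ?p" "?p < interval_start ?S (d G) u + d G u"
          "?p mod d G u = i"
        using slot[OF i] by auto
      have "(\<Sum>u\<in>?S. d G u) = (\<Sum>u\<in>?S. length (data G u))"
        using req_sub[OF G] by (intro sum.cong) (auto simp: d_def)
      \<comment> \<open>The bound on the requested words keeps every position inside the
        \<open>C\<close> batches of \<open>n\<close> positions.\<close>
      then have "?p < C * ?n G"
        using p(2) interval_end_le_total[OF fin u, of "d G"] total[OF G] by linarith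
      then have div: "?p div ?n G < C" by (simp add: less_mult_imp_div_less)
      have own: "interval_owner ?S (d G) ?p = u"
        by (rule interval_owner_eq[OF fin u p(1,2)])
      have "?p div ?n G * ?n G + ?p mod ?n G = ?p" by simp
      moreover have "?p mod ?n G \<in> verts G" using V[OF G(1)] by (metis lessThan_iff mod_less_divisor)
      ultimately have "reply (?p div ?n G) G v (?p mod ?n G) = data G u ! i"
        using G uV own p(3) i by (auto simp: reply_def ask_def stored_def d_def)
      with div show ?thesis by (simp add: Let_def)
    qed
    moreover have "length (data G u) = d G u" if "u \<in> ?S" for u
      using that req_sub[OF G] by (auto simp: d_def)
    ultimately show "(\<lambda>u. if u \<in> ?S then data G u else []) =
      (\<lambda>((F, S, e), n, _) u. if u \<in> S then
        map (\<lambda>i. let p = slot (interval_start S e u) (e u) i in F (p div n) (p mod n)) [0..<e u] else [])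
      (((\<lambda>\<rho>. if \<rho> < C then reply \<rho> G v else undefined), ?S, d G), ?n G, v, {e \<in> edges G. v \<in> e})"
      by (auto simp: fun_eq_iff intro!: nth_equalityI)
  qed
qed

section \<open>Paths in graphs of large girth\<close>

lemma simple_graph_edgeD:
  assumes "simple_graph G" "{a, b} \<in> edges G"
  shows "a \<in> verts G" "b \<in> verts G" "a \<noteq> b"
  using assms unfolding simple_graph_def by (force simp: card_insert_if)+

lemma girth_le: "cycle G c \<Longrightarrow> girth G \<le> enat (length c)"
  unfolding girth_def by (rule INF_lower) simp

lemma girth_attained:
  assumes "girth G = enat g"
  shows "\<exists>c. cycle G c \<and> length c = g"
proof -
  let ?S = "(\<lambda>p. enat (length p)) ` {p. cycle G p}"
  have "?S \<noteq> {}"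
  proof
    assume "?S = {}"
    then have "girth G = \<infinity>" unfolding girth_def by (simp only: Inf_enat_def) simp
    with assms show False by simp
  qed
  then have "girth G \<in> ?S"
    unfolding girth_def by (simp only: Inf_enat_def if_False) (rule LeastI_ex, blast)
  with assms show ?thesis by auto
qed

lemma walk_append:
  "walk G (p @ q) \<longleftrightarrow> (if p = [] then walk G q else if q = [] then walk G p
     else walk G p \<and> walk G q \<and> {last p, hd q} \<in> edges G)"
  by (auto simp: walk_def successively_append_iff)

lemma walk_Cons: "walk G (x # p) \<longleftrightarrow> x \<in> verts G \<and> (p = [] \<or> walk G p \<and> {x, hd p} \<in> edges G)"
  by (cases p) (auto simp: walk_def)

lemma walk_rev: "walk G (rev p) \<longleftrightarrow> walk G p"
proof -
  have "successively (\<lambda>x y. {x, y} \<in> edges G) (rev p) \<longleftrightarrow> successively (\<lambda>x y. {y, x} \<in> edges G) p"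
    by (simp add: successively_rev)
  also have "\<dots> \<longleftrightarrow> successively (\<lambda>x y. {x, y} \<in> edges G) p"
    by (simp add: insert_commute)
  finally show ?thesis by (simp add: walk_def)
qed

text \<open>A common inner vertex splits both paths into shorter pairs, to which induction applies.
  Without one, different paths would close up to a cycle with \<open>length p + length q - 2\<close>
  vertices.\<close>

lemma path_unique:
  assumes "walk G p" "distinct p" "walk G q" "distinct q"
    and "hd p = hd q" "last p = last q" "enat (length p + length q - 2) < girth G"
  shows "p = q"
  using assms
proof (induction "length p + length q" arbitrary: p q rule: less_induct)
  case less
  have ne: "p \<noteq> []" "q \<noteq> []" using less.prems by (auto simp: walk_def)
  show ?case
  proof (cases "hd p = last p")
    case True
    have "length xs = 1" if "distinct xs" "hd xs = last xs" "xs \<noteq> []" for xs :: "'a list"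
      using that by (cases xs) (auto split: if_splits)
    from this[of p] this[of q] True less.prems ne have "length p = 1" "length q = 1" by auto
    with less.prems(5) show ?thesis by (auto simp: length_Suc_conv)
  next
    case False
    show ?thesis
    proof (cases "\<exists>z. z \<in> set p \<and> z \<in> set q \<and> z \<noteq> hd p \<and> z \<noteq> last p")
      case True
      then obtain z where z: "z \<in> set p" "z \<in> set q" "z \<noteq> hd p" "z \<noteq> last p" by blast
      obtain p1 p2 where p: "p = p1 @ z # p2" using z(1) by (meson split_list)
      obtain q1 q2 where q: "q = q1 @ z # q2" using z(2) by (meson split_list)
      have nes: "p1 \<noteq> []" "p2 \<noteq> []" "q1 \<noteq> []" "q2 \<noteq> []"
        using z less.prems(5,6) by (auto simp: p q)
      have small: "enat m < girth G" if "m \<le> length p + length q - 2" for m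
        using that less.prems(7) by (meson enat_ord_simps(1) le_less_trans)
      have "p1 @ [z] = q1 @ [z]"
        using less.prems nes by (intro less.hyps) (auto simp: p q walk_append walk_Cons intro!: small)
      moreover have "z # p2 = z # q2"
        using less.prems nes by (intro less.hyps) (auto simp: p q walk_append walk_Cons intro!: small)
      ultimately show ?thesis by (simp add: p q)
    next
      case disj: False
      obtain a p' b where p: "p = a # p' @ [b]"
        using False ne(1) by (metis append_butlast_last_id last.simps list.exhaust_sel list.sel(1))
      obtain q' where q: "q = a # q' @ [b]"
        using False ne(2) less.prems(5,6) p
        by (metis append_butlast_last_id last.simps last_ConsR last_snoc list.exhaust_sel list.sel(1) snoc_eq_iff_butlast)
      show ?thesis
      proof (cases "p' = [] \<and> q' = []")
        case False
        \<comment> \<open>The cycle follows \<open>p\<close> and returns along the inner vertices of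
          \<open>q\<close>. As one of the paths has an inner vertex, there are at least three
          vertices in total.\<close>
        let ?c = "p @ rev q'"
        have dc: "distinct ?c"
          using less.prems(2,4) disj by (auto simp: p q)
        have "walk G ?c"
        proof (cases "q' = []")
          case q'ne: False
          have "walk G (q' @ [b])" using less.prems(3) q'ne by (simp add: q walk_append[of G "[a]" "q' @ [b]", simplified])
          then have "walk G q'" "{last q', b} \<in> edges G" using q'ne by (auto simp: walk_append split: if_splits)
          with less.prems(1) q'ne show ?thesis
            by (subst walk_append) (auto simp: walk_rev hd_rev p insert_commute)
        qed (use less.prems(1) in simp)
        moreover have "{last ?c, hd ?c} \<in> edges G"
        proof (cases "q' = []")
          case True
          with less.prems(3) show ?thesis by (simp add: p q walk_def insert_commute)
        next
          case q'ne: False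
          with less.prems(3) show ?thesis
            by (simp add: p q walk_append[of G "[a]" "q' @ [b]", simplified] last_rev insert_commute)
        qed
        ultimately have "cycle G ?c"
          using dc False unfolding cycle_def by (auto simp: p Suc_le_eq)
        from girth_le[OF this] less.prems(7) show ?thesis
          by (simp add: p q)
      qed (simp add: p q)
    qed
  qed
qed

text \<open>\<open>length\<close> counts vertices, so these paths have between \<open>1\<close> and
  \<open>l\<close> edges. The trivial path is excluded since every path is to have a last
  edge.\<close>

definition paths_from :: "'a graph \<Rightarrow> 'a \<Rightarrow> nat \<Rightarrow> 'a list set" where
  "paths_from G x l = {p. walk G p \<and> distinct p \<and> hd p = x \<and> 2 \<le> length p \<and> length p \<le> Suc l}"

lemma finite_paths_from:
  assumes "finite (verts G)"
  shows "finite (paths_from G x l)"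
proof (rule finite_subset)
  show "paths_from G x l \<subseteq> {p. set p \<subseteq> verts G \<and> length p \<le> Suc l}"
    by (auto simp: paths_from_def walk_def)
qed (rule finite_lists_length_le[OF assms])

lemma inj_on_last_paths_from:
  assumes "enat (2 * l) < girth G"
  shows "inj_on last (paths_from G x l)"
proof (rule inj_onI)
  fix p q assume pq: "p \<in> paths_from G x l" "q \<in> paths_from G x l" "last p = last q"
  then have "length p + length q - 2 \<le> 2 * l" by (auto simp: paths_from_def)
  with assms have "enat (length p + length q - 2) < girth G"
    by (meson enat_ord_simps(1) le_less_trans)
  with pq show "p = q" by (intro path_unique) (auto simp: paths_from_def)
qed

lemma card_paths_from_le:
  assumes "finite (verts G)" "enat (2 * l) < girth G"
  shows "card (paths_from G x l) \<le> card (verts G)"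
proof (rule card_inj_on_le[OF inj_on_last_paths_from[OF assms(2)] _ assms(1)])
  show "last ` paths_from G x l \<subseteq> verts G"
    by (auto simp: paths_from_def walk_def)
qed

text \<open>The part of \<open>p\<close> from \<open>b\<close> on is closed by the edge. It would be
  a cycle shorter than the girth if it had more than two vertices.\<close>

lemma back_edge_eq_last_edge:
  assumes "simple_graph G" "walk G p" "distinct p" "b \<in> set p" "{last p, b} \<in> edges G"
    "enat (length p) < girth G"
  shows "2 \<le> length p \<and> b = last (butlast p)"
proof -
  obtain p1 p2 where p: "p = p1 @ b # p2" using assms(4) by (meson split_list)
  have "p2 \<noteq> []"
    using assms(1,5) simple_graph_edgeD(3)[of G b b] by (auto simp: p)
  have "walk G (b # p2)" using assms(2) by (auto simp: p walk_append split: if_splits)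
  have "length p2 < 2"
  proof (rule ccontr)
    assume "\<not> length p2 < 2"
    then have "cycle G (b # p2)"
      using assms \<open>walk G (b # p2)\<close> \<open>p2 \<noteq> []\<close> by (auto simp: cycle_def p)
    from girth_le[OF this] assms(6) have "enat (length p) < enat (length (b # p2))" by (rule less_le_trans[rotated])
    then show False by (simp add: p)
  qed
  with \<open>p2 \<noteq> []\<close> obtain c where "p2 = [c]" by (cases p2) auto
  then show ?thesis by (simp add: p butlast_append)
qed

text \<open>Take a shortest walk to an endpoint at distance below \<open>l\<close>. If the other
  endpoint is not on it, append it; otherwise the edge already is the last one of the walk. Hence
  last edges of paths are all that has to be transmitted.\<close>

lemma edge_of_nbhd_is_last_edge:
  assumes G: "simple_graph G" and e: "e \<in> edges (nbhd G l x)" and l: "enat l < girth G"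
  shows "\<exists>p\<in>paths_from G x l. e = {last (butlast p), last p}"
proof -
  from e obtain a j where a: "e \<in> edges G" "a \<in> e" "l = Suc j" "hop_dist G x a \<le> enat j"
    unfolding nbhd_def plus_one_le_enat_iff by auto
  from a(1,2) G obtain b where b: "e = {a, b}" "a \<noteq> b"
    unfolding simple_graph_def by (metis card_2_iff doubleton_eq_iff insertE singletonD)
  let ?Q = "\<lambda>p. walk G p \<and> hd p = x \<and> last p = a \<and> length p \<le> Suc j"
  have "\<exists>p. ?Q p" using a(4) unfolding hop_dist_le_iff .
  then obtain p where p: "?Q p" "\<And>q. ?Q q \<Longrightarrow> length p \<le> length q"
    using ex_has_least_nat[of ?Q _ length] by blast
  have "distinct p"
  proof (rule ccontr)
    assume "\<not> distinct p"
    then obtain p1 z p2 p3 where q: "p = p1 @ [z] @ p2 @ [z] @ p3" by (metis not_distinct_decomp)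
    have "?Q (p1 @ [z] @ p3)"
      using p(1) by (auto simp: q walk_append walk_Cons hd_append split: if_splits)
    from p(2)[OF this] show False by (simp add: q)
  qed
  show ?thesis
  proof (cases "b \<in> set p")
    case True
    have "enat (length p) < girth G" using p(1) a(3) l by (metis enat_ord_simps(1) le_less_trans)
    with True have "2 \<le> length p \<and> b = last (butlast p)"
      using G p(1) \<open>distinct p\<close> a(1) b by (intro back_edge_eq_last_edge) auto
    with p(1) \<open>distinct p\<close> a b show ?thesis
      by (intro bexI[of _ p]) (auto simp: paths_from_def)
  next
    case False
    have "b \<in> verts G" using G a(1) b simple_graph_edgeD by metis
    then have "p @ [b] \<in> paths_from G x l"
      using p(1) \<open>distinct p\<close> False a(1,3) b
      by (auto simp: paths_from_def walk_append walk_Cons hd_append Suc_le_eq walk_def[of G "[]"])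
    with p(1) b show ?thesis by (intro bexI[of _ "p @ [b]"]) (auto simp: butlast_append walk_def)
  qed
qed

lemma hop_dist_last_le:
  assumes "p \<in> paths_from G x l"
  shows "hop_dist G x (last p) \<le> enat l"
  using assms unfolding hop_dist_le_iff paths_from_def by blast

lemma hop_dist_commute: "hop_dist G u v \<le> enat k \<longleftrightarrow> hop_dist G v u \<le> enat k"
proof -
  have "hop_dist G u v \<le> enat k \<Longrightarrow> hop_dist G v u \<le> enat k" for u v
    unfolding hop_dist_le_iff
    by (metis hd_rev last_rev length_rev walk_rev)
  then show ?thesis by blast
qed

lemma hop_dist_triangle:
  assumes "hop_dist G u v \<le> enat j" "hop_dist G v w \<le> enat k"
  shows "hop_dist G u w \<le> enat (j + k)"
proof -
  obtain p q where p: "walk G p" "hd p = u" "last p = v" "length p \<le> Suc j"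
    and q: "walk G q" "hd q = v" "last q = w" "length q \<le> Suc k"
    using assms unfolding hop_dist_le_iff by blast
  obtain q' where q': "q = v # q'" using q(1,2) by (cases q) (auto simp: walk_def)
  have "walk G (p @ q')"
    using p(1,3) q(1) by (auto simp: q' walk_append walk_Cons)
  moreover have "hd (p @ q') = u" "last (p @ q') = w" "length (p @ q') \<le> Suc (j + k)"
    using p q by (auto simp: q' walk_def)
  ultimately show ?thesis unfolding hop_dist_le_iff by blast
qed

lemma nbhd_edges_mono:
  assumes "hop_dist G c x \<le> enat k"
  shows "edges (nbhd G l x) \<subseteq> edges (nbhd G (k + l) c)"
proof
  fix e assume "e \<in> edges (nbhd G l x)"
  then obtain a j where a: "e \<in> edges G" "a \<in> e" "l = Suc j" "hop_dist G x a \<le> enat j"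
    unfolding nbhd_def plus_one_le_enat_iff by auto
  from hop_dist_triangle[OF assms a(4)] a(1-3) show "e \<in> edges (nbhd G (k + l) c)"
    unfolding nbhd_def plus_one_le_enat_iff by auto
qed

section \<open>The Moore bound\<close>

definition nbrs :: "'a graph \<Rightarrow> 'a \<Rightarrow> 'a set" where
  "nbrs G v = {u. {v, u} \<in> edges G}"

lemma nbrs_sym: "u \<in> nbrs G v \<longleftrightarrow> v \<in> nbrs G u"
  by (simp add: nbrs_def insert_commute)

lemma nbrs_subset: "simple_graph G \<Longrightarrow> nbrs G v \<subseteq> verts G - {v}"
  by (auto simp: nbrs_def dest: simple_graph_edgeD)

lemma finite_nbrs: "simple_graph G \<Longrightarrow> finite (nbrs G v)"
  using nbrs_subset[of G v] by (auto simp: simple_graph_def intro: finite_subset)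

lemma nbrs_empty: "simple_graph G \<Longrightarrow> v \<notin> verts G \<Longrightarrow> nbrs G v = {}"
  by (auto simp: nbrs_def dest: simple_graph_edgeD)

text \<open>Twice the number of edges of the subgraph induced by \<open>W\<close>.\<close>

definition inner_degrees :: "'a graph \<Rightarrow> 'a set \<Rightarrow> nat" where
  "inner_degrees G W = (\<Sum>v\<in>W. card (nbrs G v \<inter> W))"

lemma inner_degrees_remove:
  assumes G: "simple_graph G" and W: "finite W" "v \<in> W"
  shows "inner_degrees G W = inner_degrees G (W - {v}) + 2 * card (nbrs G v \<inter> W)"
proof -
  have "card (nbrs G u \<inter> W) = card (nbrs G u \<inter> (W - {v})) + (if u \<in> nbrs G v then 1 else 0)" for u
  proof (cases "u \<in> nbrs G v")
    case True
    then have "nbrs G u \<inter> W = insert v (nbrs G u \<inter> (W - {v}))"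
      using W nbrs_sym by fast
    then show ?thesis using True finite_nbrs[OF G] by simp
  next
    case False
    then have "nbrs G u \<inter> W = nbrs G u \<inter> (W - {v})" using nbrs_sym by fast
    then show ?thesis using False by simp
  qed
  then have "(\<Sum>u\<in>W - {v}. card (nbrs G u \<inter> W))
      = inner_degrees G (W - {v}) + (\<Sum>u\<in>W - {v}. if u \<in> nbrs G v then 1 else 0)"
    by (simp add: inner_degrees_def sum.distrib)
  also have "(\<Sum>u\<in>W - {v}. if u \<in> nbrs G v then 1 else 0 :: nat) = card (nbrs G v \<inter> W)"
  proof -
    have "nbrs G v \<inter> W = (W - {v}) \<inter> nbrs G v" using nbrs_subset[OF G, of v] by auto
    then show ?thesis using W by (simp add: sum.If_cases Int_def conj_commute)
  qed
  finally show ?thesis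
    using W by (simp add: inner_degrees_def sum.remove)
qed

text \<open>Delete vertices with at most \<open>D\<close> remaining neighbors. Each deletion lowers
  the degree sum by at most \<open>2 * D\<close>, so the strict inequality persists; as it fails for
  the empty set, the deletion stops earlier.\<close>

lemma dense_has_large_min_degree:
  assumes G: "simple_graph G" and "finite W" "2 * D * card W < inner_degrees G W"
  shows "\<exists>U\<subseteq>W. U \<noteq> {} \<and> (\<forall>v\<in>U. D < card (nbrs G v \<inter> U))"
  using assms(2,3)
proof (induction "card W" arbitrary: W rule: less_induct)
  case less
  show ?case
  proof (cases "\<forall>v\<in>W. D < card (nbrs G v \<inter> W)")
    case True
    moreover have "W \<noteq> {}" using less.prems(2) by (auto simp: inner_degrees_def)
    ultimately show ?thesis by blast
  next
    case False
    then obtain v where v: "v \<in> W" "card (nbrs G v \<inter> W) \<le> D" by (auto simp: not_less)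
    have c: "card W = Suc (card (W - {v}))"
      using less.prems(1) v(1) by (metis card.remove)
    have "2 * D * card (W - {v}) < inner_degrees G (W - {v})"
      using less.prems(2) inner_degrees_remove[OF G less.prems(1) v(1)] v(2) by (simp add: c)
    from less.hyps[OF _ _ this] c less.prems(1) show ?thesis by auto
  qed
qed

text \<open>A weak form of the Moore bound: otherwise, a subgraph of minimum degree above \<open>D\<close> contains at
  least \<open>D ^ k\<close> paths with \<open>k\<close> edges from any of its vertices, and their endpoints are distinct.\<close>

lemma moore_bound:
  assumes G: "simple_graph G" and W: "W \<subseteq> verts G"
    and g: "enat (2 * k) < girth G" and D: "card (verts G) < D ^ k"
  shows "inner_degrees G W \<le> 2 * D * card W"
proof (rule ccontr)
  assume "\<not> ?thesis"
  moreover have fV: "finite (verts G)" using G by (simp add: simple_graph_def)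
  then have "finite W" using W by (rule finite_subset[rotated])
  ultimately obtain U where U: "U \<subseteq> W" "U \<noteq> {}" "\<And>v. v \<in> U \<Longrightarrow> D < card (nbrs G v \<inter> U)"
    using dense_has_large_min_degree[OF G, of W D] by (auto simp: not_le)
  obtain v where v: "v \<in> U" using U by blast
  define N where
    "N i = {p. walk G p \<and> distinct p \<and> set p \<subseteq> U \<and> hd p = v \<and> length p = Suc i}" for i
  have fN: "finite (N i)" for i
    by (rule finite_subset[OF _ finite_lists_length_eq[OF fV, of "Suc i"]])
      (auto simp: N_def walk_def)
  have "D ^ i \<le> card (N i)" if "i \<le> k" for i
    using that
  proof (induction i)
    case 0
    have "[v] \<in> N 0" using v U(1) W by (auto simp: N_def walk_def)
    then show ?case using fN[of 0] by (metis One_nat_def Suc_leI card_gt_0_iff empty_iff power_0)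
  next
    case (Suc i)
    define B where "B p = nbrs G (last p) \<inter> U - set p" for p
    have fB: "finite (B p)" for p using finite_nbrs[OF G] by (simp add: B_def)
    have cB: "D \<le> card (B p)" if p: "p \<in> N i" for p
    proof -
      \<comment> \<open>By the girth, only the predecessor of \<open>last p\<close> can be a
        neighbor of it on \<open>p\<close>. Of its more than \<open>D\<close> neighbors in
        \<open>U\<close>, at least \<open>D\<close> therefore extend the path.\<close>
      have "nbrs G (last p) \<inter> U \<inter> set p \<subseteq> {last (butlast p)}"
      proof
        fix b assume b: "b \<in> nbrs G (last p) \<inter> U \<inter> set p"
        have "length p \<le> 2 * k" using p Suc.prems by (simp add: N_def)
        then have "enat (length p) < girth G" using g by (meson enat_ord_simps(1) le_less_trans)
        with b p show "b \<in> {last (butlast p)}"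
          using back_edge_eq_last_edge[OF G, of p b] by (simp add: N_def nbrs_def)
      qed
      then have "card (nbrs G (last p) \<inter> U \<inter> set p) \<le> 1"
        by (metis card.empty card_insert_disjoint card_mono empty_iff finite.intros One_nat_def)
      moreover have "D < card (nbrs G (last p) \<inter> U)"
        using p by (intro U(3)) (auto simp: N_def walk_def)
      moreover have "card (nbrs G (last p) \<inter> U) = card (B p) + card (nbrs G (last p) \<inter> U \<inter> set p)"
        unfolding B_def using finite_nbrs[OF G, of "last p"]
        by (metis Diff_disjoint Un_Diff_Int card_Un_disjoint finite_Diff finite_Int Int_commute inf_assoc inf_bot_right Diff_Int_distrib)
      ultimately show ?thesis by linarith
    qed
    have "D ^ Suc i \<le> (\<Sum>p\<in>N i. D)" using Suc by simp
    also have "\<dots> \<le> (\<Sum>p\<in>N i. card (B p))" by (intro sum_mono cB)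
    also have "\<dots> = card (SIGMA p:N i. B p)" using fN fB by simp
    also have "\<dots> \<le> card (N (Suc i))"
    proof (rule card_inj_on_le[OF _ _ fN])
      show "inj_on (\<lambda>(p, b). p @ [b]) (SIGMA p:N i. B p)" by (auto simp: inj_on_def)
      show "(\<lambda>(p, b). p @ [b]) ` (SIGMA p:N i. B p) \<subseteq> N (Suc i)"
        using W U(1) by (auto simp: N_def B_def nbrs_def walk_append walk_Cons hd_append walk_def[of G "[]"])
    qed
    finally show ?case .
  qed
  then have "D ^ k \<le> card (N k)" by simp
  also have "\<dots> \<le> card (verts G)"
  proof (rule card_inj_on_le[OF _ _ fV])
    show "inj_on last (N k)"
      using g by (intro inj_onI path_unique) (auto simp: N_def mult_2)
    show "last ` N k \<subseteq> verts G" by (auto simp: N_def walk_def)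
  qed
  finally show False using D by simp
qed

section \<open>Counting the sets of parts\<close>

definition small_subsets :: "nat \<Rightarrow> nat \<Rightarrow> nat set set" where
  "small_subsets P l = {Q. Q \<subseteq> {..<P} \<and> card Q \<le> l}"

lemma finite_small_subsets: "finite (small_subsets P l)"
  by (rule finite_subset[of _ "Pow {..<P}"]) (auto simp: small_subsets_def)

lemma small_subsets_0: "small_subsets 0 l = {{}}"
  by (auto simp: small_subsets_def)

text \<open>For \<open>j \<le> l\<close> the weight \<open>c ^ l * (1 / c) ^ j\<close> is at least
  \<open>1\<close>. By the binomial theorem the weighted sum is at most
  \<open>c ^ l * (1 + 1 / c) ^ (c * l)\<close>, and
  \<open>(1 + 1 / c) ^ c \<le> exp 1 \<le> 3\<close>.\<close>

lemma card_small_subsets_le: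
  assumes "0 < c"
  shows "card (small_subsets (c * l) l) \<le> (3 * c) ^ l"
proof -
  have "small_subsets (c * l) l = (\<Union>j\<le>l. {Q. Q \<subseteq> {..<c * l} \<and> card Q = j})"
    by (auto simp: small_subsets_def)
  then have "card (small_subsets (c * l) l) \<le> (\<Sum>j\<le>l. card {Q. Q \<subseteq> {..<c * l} \<and> card Q = j})"
    by (simp add: card_UN_le)
  also have "\<dots> = (\<Sum>j\<le>l. (c * l) choose j)" by (simp add: n_subsets)
  finally have "real (card (small_subsets (c * l) l)) \<le> real (\<Sum>j\<le>l. (c * l) choose j)"
    by (rule of_nat_mono)
  also have "\<dots> = (\<Sum>j\<le>l. real ((c * l) choose j))" by simp
  also have "\<dots> \<le> (\<Sum>j\<le>l. real c ^ l * (real ((c * l) choose j) * (1 / real c) ^ j))"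
  proof (rule sum_mono)
    fix j assume "j \<in> {..l}"
    then have "1 \<le> real c ^ l * (1 / real c) ^ j"
      using assms power_increasing[of j l "real c"] by (simp add: power_one_over field_simps)
    from mult_left_mono[OF this, of "real ((c * l) choose j)"]
    show "real ((c * l) choose j) \<le> real c ^ l * (real ((c * l) choose j) * (1 / real c) ^ j)"
      by (simp add: mult_ac)
  qed
  also have "\<dots> \<le> (\<Sum>j\<le>c * l. real c ^ l * (real ((c * l) choose j) * (1 / real c) ^ j))"
    using assms by (intro sum_mono2) (auto intro: order_trans[of _ "1 * l"])
  also have "\<dots> = real c ^ l * (1 / real c + 1) ^ (c * l)"
    by (simp add: binomial_ring sum_distrib_left)
  also have "\<dots> \<le> real c ^ l * exp (1 / real c) ^ (c * l)"
    using exp_ge_add_one_self[of "1 / real c"] by (intro mult_left_mono power_mono) (auto simp: add.commute)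
  also have "exp (1 / real c) ^ (c * l) = exp 1 ^ l"
    using assms by (simp add: exp_of_nat_mult[symmetric])
  also have "real c ^ l * exp 1 ^ l \<le> real c ^ l * 3 ^ l"
    by (intro mult_left_mono power_mono exp_le) auto
  also have "\<dots> = real ((3 * c) ^ l)" by (simp add: power_mult_distrib)
  finally show ?thesis by (simp only: of_nat_le_iff)
qed

text \<open>\<open>P\<close> is the number of parts and \<open>q l\<close> the number of sets of at
  most \<open>l\<close> parts. The conditions say in turn that the average part has a vertex, that
  at least one path can be told for each set, and that there are enough nodes for the collectors and
  for the detectors.\<close>

definition feasible :: "nat \<Rightarrow> nat \<Rightarrow> nat \<Rightarrow> bool" where
  "feasible n t \<rho> \<longleftrightarrow> (let P = 6 * \<rho> * t; q = \<lambda>l. card (small_subsets P l) in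
     P \<le> n \<and> q \<rho> \<le> n \<and> q (3 * \<rho>) * (q \<rho> * (n div (n div q \<rho>))) \<le> n \<and> q (6 * \<rho>) \<le> n)"

text \<open>With \<open>X = (18 * t) ^ \<rho>\<close>, the three numbers of sets are at most
  \<open>X\<close>, \<open>X ^ 3\<close> and \<open>X ^ 6\<close>. The collectors number at most
  \<open>X ^ 3 * (X * (2 * X))\<close>, which is at most \<open>X ^ 6\<close> since
  \<open>2 \<le> X\<close>.\<close>

lemma feasibleI:
  assumes n: "0 < n" and t: "t = 0 \<or> (18 * t) ^ (6 * \<rho>) \<le> n"
  shows "feasible n t \<rho>"
proof (cases "t = 0 \<or> \<rho> = 0")
  case True
  then have "6 * \<rho> * t = 0" by auto
  then show ?thesis using n by (simp only: feasible_def Let_def small_subsets_0) simp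
next
  case False
  define X where "X = (18 * t) ^ \<rho>"
  let ?q = "\<lambda>l. card (small_subsets (6 * \<rho> * t) l)"
  have "X ^ 6 = (18 * t) ^ (6 * \<rho>)" by (simp only: X_def power_mult[symmetric] mult.commute)
  then have X6: "X ^ 6 \<le> n" using t False by simp
  have X2: "2 \<le> X"
  proof -
    have "2 \<le> 18 * t" using False by simp
    also have "\<dots> \<le> X" unfolding X_def using False by (intro self_le_power) auto
    finally show ?thesis .
  qed
  have q1: "?q \<rho> \<le> X"
    using card_small_subsets_le[of "6 * t" \<rho>] False by (simp add: X_def mult_ac)
  have q3: "?q (3 * \<rho>) \<le> X ^ 3"
  proof -
    have "?q (3 * \<rho>) \<le> (6 * t) ^ (3 * \<rho>)"
      using card_small_subsets_le[of "2 * t" "3 * \<rho>"] False by (simp add: mult_ac)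
    also have "\<dots> \<le> (18 * t) ^ (3 * \<rho>)" by (intro power_mono) auto
    also have "\<dots> = X ^ 3" by (simp only: X_def power_mult[symmetric] mult.commute)
    finally show ?thesis .
  qed
  have q6: "?q (6 * \<rho>) \<le> X ^ 6"
  proof -
    have "?q (6 * \<rho>) \<le> (3 * t) ^ (6 * \<rho>)"
      using card_small_subsets_le[of "t" "6 * \<rho>"] False by (simp add: mult_ac)
    also have "\<dots> \<le> (18 * t) ^ (6 * \<rho>)" by (intro power_mono) auto
    also have "\<dots> = X ^ 6" by (simp only: X_def power_mult[symmetric] mult.commute)
    finally show ?thesis .
  qed
  have XX: "X \<le> X ^ 6" using X2 by (intro self_le_power) auto
  have qn: "?q \<rho> \<le> n" using q1 XX X6 by linarith
  have q0: "0 < ?q \<rho>"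
  proof -
    have "{} \<in> small_subsets (6 * \<rho> * t) \<rho>" by (simp add: small_subsets_def)
    then show ?thesis using finite_small_subsets card_gt_0_iff by blast
  qed
  \<comment> \<open>The inner quotient \<open>m\<close> is positive, so
    \<open>m + 1 \<le> 2 * m\<close>: rounding costs at most a factor of two.\<close>
  have kappa: "n div (n div ?q \<rho>) \<le> 2 * X"
  proof -
    define m where "m = n div ?q \<rho>"
    have m: "1 \<le> m" using qn q0 by (simp add: m_def div_greater_zero_iff Suc_le_eq)
    have "n < (m + 1) * ?q \<rho>"
      unfolding m_def using q0 by (metis Suc_eq_plus1 dividend_less_times_div mult.commute mult_Suc_right)
    also have "\<dots> \<le> (2 * m) * ?q \<rho>" using m by (intro mult_right_mono) auto
    finally have "n < (2 * ?q \<rho>) * m" by (simp add: mult_ac)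
    then have "n div m < 2 * ?q \<rho>" by (simp add: less_mult_imp_div_less)
    then show ?thesis using q1 by (simp add: m_def)
  qed
  have "?q (3 * \<rho>) * (?q \<rho> * (n div (n div ?q \<rho>))) \<le> X ^ 3 * (X * (2 * X))"
    by (intro mult_mono q1 q3 kappa) auto
  also have "\<dots> = 2 * X ^ 5" by (simp add: power_numeral_reduce)
  also have "\<dots> \<le> X * X ^ 5" using X2 by (intro mult_right_mono) auto
  also have "\<dots> \<le> n" using X6 by (simp add: power_numeral_reduce)
  finally have R2: "?q (3 * \<rho>) * (?q \<rho> * (n div (n div ?q \<rho>))) \<le> n" .
  have "6 * \<rho> * t \<le> n"
  proof -
    have "\<rho> \<le> 2 ^ \<rho>" using less_exp[of \<rho>] by (rule less_imp_le)
    also have "(2::nat) ^ \<rho> \<le> X" unfolding X_def using False by (intro power_mono) auto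
    finally have "\<rho> \<le> X" .
    moreover have "18 * t \<le> X" unfolding X_def using False by (intro self_le_power) auto
    ultimately have "\<rho> * (6 * t) \<le> X * X" by (intro mult_mono) auto
    also have "\<dots> = X ^ 2" by (simp add: power2_eq_square)
    also have "\<dots> \<le> X ^ 6" using X2 by (intro power_increasing) auto
    finally show ?thesis using X6 by (simp add: mult_ac)
  qed
  then show ?thesis
    using qn R2 q6 X6 unfolding feasible_def Let_def by linarith
qed

section \<open>Orienting the edges\<close>

text \<open>\<open>core\<close> is the H-index of the degrees of the neighbors: it is at least \<open>t \<ge> 1\<close> iff at least \<open>t\<close>
  neighbors have degree at least \<open>t\<close>. Having one broadcast \<open>core\<close>, all nodes know, for every \<open>t\<close>,
  who survives two rounds of discarding the vertices of degree less than \<open>t\<close>.\<close>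

definition core :: "'a graph \<Rightarrow> 'a \<Rightarrow> nat" where
  "core G v = card {t \<in> {1..card (verts G)}. t \<le> card {u \<in> nbrs G v. t \<le> card (nbrs G u)}}"

text \<open>For a heavy vertex this is the number of edges it owns. It does not refer to the
  threshold, so it can be broadcast before the threshold is known.\<close>

definition out_bound :: "'a graph \<Rightarrow> 'a \<Rightarrow> nat" where
  "out_bound G v = card {u \<in> nbrs G v. core G v \<le> core G u}"

text \<open>The constant is \<open>64 * 18\<^sup>2\<close>: the factor \<open>18\<close> comes from the number of sets of parts and \<open>64\<close> from
  the Moore bound, and both have to be absorbed to get \<open>(18 * threshold G) ^ (6 * r) \<le> n\<close>.\<close>

definition threshold :: "'a graph \<Rightarrow> nat" where
  "threshold G = (LEAST t. (\<Sum>v\<in>{v \<in> verts G. t < core G v}. out_bound G v) \<le> 20736 * card (verts G))"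

definition heavy :: "'a graph \<Rightarrow> 'a \<Rightarrow> bool" where
  "heavy G v \<longleftrightarrow> threshold G < core G v"

text \<open>An edge between heavy vertices goes to the smaller core, and ties give it to both ends.
  A light vertex of degree above the threshold leaves the edges to vertices of lower degree to them
  and keeps at most \<open>threshold G\<close> edges, by the meaning of \<open>core\<close>. A
  vertex of degree at most the threshold owns all its edges.\<close>

definition owns :: "'a graph \<Rightarrow> 'a \<Rightarrow> 'a \<Rightarrow> bool" where
  "owns G u v \<longleftrightarrow> (if heavy G u then core G u \<le> core G v
     else threshold G < card (nbrs G u) \<longrightarrow> threshold G < card (nbrs G v))"

definition owned :: "'a graph \<Rightarrow> 'a \<Rightarrow> 'a set" where
  "owned G u = {v \<in> nbrs G u. owns G u v}"

definition owner :: "'a graph \<Rightarrow> 'a \<Rightarrow> 'a \<Rightarrow> 'a" where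
  "owner G a b = (if owns G a b then a else b)"

lemma card_nbrs_less:
  assumes "simple_graph G" "v \<in> verts G"
  shows "card (nbrs G v) < card (verts G)"
  using assms nbrs_subset[OF assms(1), of v]
  by (intro psubset_card_mono) (auto simp: simple_graph_def)

lemma card_nbrs_le:
  assumes "simple_graph G"
  shows "card (nbrs G v) \<le> card (verts G)"
  using assms nbrs_subset[OF assms(1), of v]
  by (intro card_mono) (auto simp: simple_graph_def)

text \<open>Raising \<open>t\<close> shrinks the set of neighbors of degree at least
  \<open>t\<close>. So the values of \<open>t\<close> counted by \<open>core\<close> form an initial
  segment of the positive integers, and membership can be read off from its cardinality.\<close>

lemma le_core_iff:
  assumes G: "simple_graph G" and t: "1 \<le> t"
  shows "t \<le> core G v \<longleftrightarrow> t \<le> card {u \<in> nbrs G v. t \<le> card (nbrs G u)}"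
proof -
  define S where
    "S = {t \<in> {1..card (verts G)}. t \<le> card {u \<in> nbrs G v. t \<le> card (nbrs G u)}}"
  have anti: "card {u \<in> nbrs G v. t \<le> card (nbrs G u)} \<le> card {u \<in> nbrs G v. s \<le> card (nbrs G u)}"
    if "s \<le> t" for s t
    using that finite_nbrs[OF G] by (intro card_mono) auto
  have "t \<in> S" if "t \<le> card {u \<in> nbrs G v. t \<le> card (nbrs G u)}"
  proof -
    have "card {u \<in> nbrs G v. t \<le> card (nbrs G u)} \<le> card (nbrs G v)"
      using finite_nbrs[OF G] by (intro card_mono) auto
    with that card_nbrs_le[OF G, of v] t show ?thesis by (simp add: S_def)
  qed
  then have "t \<in> S \<longleftrightarrow> t \<le> card {u \<in> nbrs G v. t \<le> card (nbrs G u)}"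
    by (auto simp: S_def)
  moreover have "t \<in> S \<longleftrightarrow> t \<le> card S"
  proof
    assume "t \<in> S"
    then have "{1..t} \<subseteq> S"
      using anti by (auto simp: S_def) (meson anti le_trans)
    then have "card {1..t} \<le> card S" by (intro card_mono) (auto simp: S_def)
    then show "t \<le> card S" by simp
  next
    assume le: "t \<le> card S"
    show "t \<in> S"
    proof (rule ccontr)
      assume "t \<notin> S"
      have "S \<subseteq> {1..<t}"
      proof
        fix s assume s: "s \<in> S"
        have "s < t"
        proof (rule ccontr)
          assume "\<not> s < t"
          then have "t \<le> s" by simp
          with s anti[of t s] t have "t \<in> S" by (auto simp: S_def)
          with \<open>t \<notin> S\<close> show False by simp
        qed
        with s show "s \<in> {1..<t}" by (simp add: S_def)
      qed
      then have "card S \<le> card {1..<t}" by (intro card_mono) auto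
      with le t show False by simp
    qed
  qed
  ultimately show ?thesis by (simp add: core_def S_def)
qed

lemma core_le:
  assumes G: "simple_graph G"
  shows "core G v \<le> card (nbrs G v)"
proof (cases "core G v = 0")
  case False
  then have "core G v \<le> card {u \<in> nbrs G v. core G v \<le> card (nbrs G u)}"
    using le_core_iff[OF G, of "core G v" v] by simp
  also have "\<dots> \<le> card (nbrs G v)"
    using finite_nbrs[OF G] by (intro card_mono) auto
  finally show ?thesis .
qed simp

lemma threshold:
  assumes G: "simple_graph G"
  shows "(\<Sum>v\<in>{v \<in> verts G. heavy G v}. out_bound G v) \<le> 20736 * card (verts G)"
  unfolding heavy_def threshold_def
proof (rule LeastI)
  \<comment> \<open>The number of vertices is a witness for \<open>LEAST\<close>: no core exceeds
    it.\<close>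
  have "{v \<in> verts G. card (verts G) < core G v} = {}"
    using core_le[OF G] card_nbrs_le[OF G] by (auto simp: not_less intro: le_trans)
  then show "(\<Sum>v\<in>{v \<in> verts G. card (verts G) < core G v}. out_bound G v) \<le> 20736 * card (verts G)"
    by (simp only: sum.empty)
qed

lemma finite_owned: "simple_graph G \<Longrightarrow> finite (owned G v)"
  using finite_nbrs[of G v] by (simp add: owned_def)

lemma card_owned_light:
  assumes G: "simple_graph G" and "\<not> heavy G v"
  shows "card (owned G v) \<le> threshold G"
proof (cases "threshold G < card (nbrs G v)")
  case True
  then have "owned G v = {u \<in> nbrs G v. Suc (threshold G) \<le> card (nbrs G u)}"
    using assms(2) by (auto simp: owned_def owns_def)
  moreover have "\<not> Suc (threshold G) \<le> card {u \<in> nbrs G v. Suc (threshold G) \<le> card (nbrs G u)}"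
    using assms le_core_iff[OF G, of "Suc (threshold G)" v] by (simp add: heavy_def Suc_le_eq)
  ultimately show ?thesis by simp
next
  case False
  have "card (owned G v) \<le> card (nbrs G v)"
    using finite_nbrs[OF G] by (intro card_mono) (auto simp: owned_def)
  with False show ?thesis by simp
qed

lemma owns_or_owns:
  assumes G: "simple_graph G"
  shows "owns G u v \<or> owns G v u"
  using core_le[OF G, of u] core_le[OF G, of v] unfolding owns_def heavy_def by auto

lemma owner_owned:
  assumes G: "simple_graph G" and "{a, b} \<in> edges G"
  shows "owner G a b = a \<and> b \<in> owned G a \<or> owner G a b = b \<and> a \<in> owned G b"
  using assms(2) owns_or_owns[OF G, of a b]
  by (auto simp: owner_def owned_def nbrs_def insert_commute)

text \<open>Let \<open>U1\<close> and \<open>U2\<close> be the vertices of degree and of core at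
  least \<open>t\<close>. The Moore bound for the whole graph, for \<open>U1\<close> and for
  \<open>U2\<close> gives three inequalities; chaining them eliminates both cardinalities.\<close>

lemma threshold_bound:
  assumes G: "simple_graph G" and V: "0 < card (verts G)"
    and g: "enat (2 * k) < girth G" and D: "card (verts G) < D ^ k"
  shows "threshold G = 0 \<or> 20736 * threshold G ^ 2 < 8 * D ^ 3"
proof (cases "threshold G = 0")
  case False
  let ?n = "card (verts G)"
  define t where "t = threshold G"
  have t: "1 \<le> t" using False by (simp add: t_def)
  have fV: "finite (verts G)" using G by (simp add: simple_graph_def)
  define U1 where "U1 = {v \<in> verts G. t \<le> card (nbrs G v)}"
  define U2 where "U2 = {v \<in> verts G. t \<le> core G v}"
  have U2: "U2 \<subseteq> U1" using core_le[OF G] by (auto simp: U1_def U2_def intro: le_trans)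
  have sub: "U1 \<subseteq> verts G" "U2 \<subseteq> verts G" by (auto simp: U1_def U2_def)
  have fin: "finite U1" "finite U2" using sub fV finite_subset by blast+
  note moore = moore_bound[OF G _ g D]
  have "t * card U1 \<le> inner_degrees G (verts G)"
  proof -
    have "t * card U1 = (\<Sum>v\<in>U1. t)" by simp
    also have "\<dots> \<le> (\<Sum>v\<in>U1. card (nbrs G v))" by (intro sum_mono) (simp add: U1_def)
    also have "\<dots> \<le> (\<Sum>v\<in>verts G. card (nbrs G v))" using sub fV by (intro sum_mono2) auto
    also have "\<dots> = inner_degrees G (verts G)"
      unfolding inner_degrees_def
      by (intro sum.cong refl arg_cong[where f = card]) (use nbrs_subset[OF G] in blast)
    finally show ?thesis .
  qed
  also have "\<dots> \<le> 2 * D * ?n" by (rule moore) simp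
  finally have 1: "t * card U1 \<le> 2 * D * ?n" .
  have "t * card U2 \<le> inner_degrees G U1"
  proof -
    have "t * card U2 = (\<Sum>v\<in>U2. t)" by simp
    also have "\<dots> \<le> (\<Sum>v\<in>U2. card (nbrs G v \<inter> U1))"
    proof (rule sum_mono)
      fix v assume "v \<in> U2"
      then have "t \<le> card {u \<in> nbrs G v. t \<le> card (nbrs G u)}"
        using le_core_iff[OF G t] by (simp add: U2_def)
      also have "{u \<in> nbrs G v. t \<le> card (nbrs G u)} = nbrs G v \<inter> U1"
        using nbrs_subset[OF G] by (auto simp: U1_def)
      finally show "t \<le> card (nbrs G v \<inter> U1)" .
    qed
    also have "\<dots> \<le> inner_degrees G U1"
      unfolding inner_degrees_def using U2 fin by (intro sum_mono2) auto
    finally show ?thesis .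
  qed
  also have "\<dots> \<le> 2 * D * card U1" by (rule moore[OF sub(1)])
  finally have 2: "t * card U2 \<le> 2 * D * card U1" .
  \<comment> \<open>Minimality of the threshold: \<open>t - 1\<close> violates the defining
    inequality.\<close>
  have "\<not> (\<Sum>v\<in>{v \<in> verts G. t - 1 < core G v}. out_bound G v) \<le> 20736 * ?n"
    using t unfolding t_def threshold_def by (intro not_less_Least) (simp add: t_def threshold_def)
  moreover have "{v \<in> verts G. t - 1 < core G v} = U2" using t by (auto simp: U2_def)
  ultimately have "20736 * ?n < (\<Sum>v\<in>U2. out_bound G v)" by simp
  also have "\<dots> \<le> inner_degrees G U2"
    unfolding inner_degrees_def out_bound_def
  proof (intro sum_mono card_mono)
    fix v assume "v \<in> U2"
    then show "{u \<in> nbrs G v. core G v \<le> core G u} \<subseteq> nbrs G v \<inter> U2"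
      using nbrs_subset[OF G, of v] by (auto simp: U2_def)
  qed (use fin in auto)
  also have "\<dots> \<le> 2 * D * card U2" by (rule moore[OF sub(2)])
  finally have 3: "20736 * ?n < 2 * D * card U2" .
  have "(20736 * t ^ 2) * ?n < (2 * D * card U2) * t ^ 2"
    using 3 t by (simp add: mult_ac)
  also have "\<dots> = 2 * D * t * (t * card U2)" by (simp add: power2_eq_square)
  also have "\<dots> \<le> 2 * D * t * (2 * D * card U1)" using 2 by (intro mult_left_mono) auto
  also have "\<dots> = 4 * D ^ 2 * (t * card U1)" by (simp add: power2_eq_square)
  also have "\<dots> \<le> 4 * D ^ 2 * (2 * D * ?n)" using 1 by (intro mult_left_mono) auto
  also have "\<dots> = (8 * D ^ 3) * ?n" by (simp add: power2_eq_square power3_eq_cube)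
  finally show ?thesis by (simp add: t_def)
qed simp

text \<open>Girth above \<open>18 * r\<close> admits the Moore bound with \<open>k = 9 * r\<close>.
  For the least suitable \<open>D\<close>, \<open>(D - 1) ^ k \<le> n\<close> and
  \<open>D \<le> 2 * (D - 1)\<close>, so dividing by \<open>64\<close> leaves
  \<open>(18 * threshold G) ^ 2 \<le> (D - 1) ^ 3\<close>. The power \<open>3 * r\<close> of this is
  the claim.\<close>

lemma threshold_power_le:
  assumes G: "simple_graph G" and V: "0 < card (verts G)" and g: "enat (18 * r) < girth G"
  shows "threshold G = 0 \<or> (18 * threshold G) ^ (6 * r) \<le> card (verts G)"
proof (cases "r = 0 \<or> threshold G = 0")
  case False
  let ?n = "card (verts G)"
  let ?k = "9 * r"
  have "?n < 2 ^ ?n" by (rule less_exp)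
  also have "\<dots> \<le> (2 ^ ?n) ^ ?k" using False by (intro self_le_power) auto
  finally have ex: "\<exists>D. ?n < D ^ ?k" by blast
  define D where "D = (LEAST D. ?n < D ^ ?k)"
  have D: "?n < D ^ ?k" unfolding D_def using ex by (rule LeastI_ex)
  have "D \<noteq> 0"
  proof
    assume "D = 0"
    with D False show False by (simp add: zero_power)
  qed
  moreover have "D \<noteq> 1" using D V by auto
  ultimately have D1: "D \<noteq> 0" "D \<noteq> 1" by auto
  then have "\<not> ?n < (D - 1) ^ ?k" unfolding D_def by (intro not_less_Least) (simp add: D_def)
  then have k: "(D - 1) ^ ?k \<le> ?n" by simp
  have "20736 * threshold G ^ 2 < 8 * D ^ 3"
    using threshold_bound[OF G V _ D] g False by simp
  also have "\<dots> \<le> 8 * (2 * (D - 1)) ^ 3" using D1 by (intro mult_left_mono power_mono) auto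
  also have "\<dots> = 64 * (D - 1) ^ 3" by (simp add: power_mult_distrib)
  finally have "(18 * threshold G) ^ 2 \<le> (D - 1) ^ 3" by (simp add: power_mult_distrib)
  then have "((18 * threshold G) ^ 2) ^ (3 * r) \<le> ((D - 1) ^ 3) ^ (3 * r)"
    by (rule power_mono) simp
  also have "\<dots> = (D - 1) ^ ?k" by (simp flip: power_mult)
  also have "\<dots> \<le> ?n" by (rule k)
  also have "((18 * threshold G) ^ 2) ^ (3 * r) = (18 * threshold G) ^ (6 * r)"
    by (simp only: power_mult[symmetric]) simp
  finally show ?thesis by simp
qed (use V in auto)

section \<open>Distributing the edges\<close>

text \<open>A node picks any instance compatible with what it knows and evaluates \<open>g\<close>
  there. Learnability thus reduces to a congruence: equal knowledge gives equal values.\<close>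

lemma learnable_factor:
  assumes f: "learnable \<G> f"
    and eq: "\<And>G v G' v'. G \<in> \<G> \<Longrightarrow> v \<in> verts G \<Longrightarrow> G' \<in> \<G> \<Longrightarrow> v' \<in> verts G' \<Longrightarrow>
      f G v = f G' v' \<Longrightarrow> g G v = g G' v'"
  shows "learnable \<G> g"
proof (rule learnable_map[OF f])
  fix G v assume Gv: "G \<in> \<G>" "v \<in> verts G"
  let ?P = "\<lambda>y. \<exists>G'\<in>\<G>. \<exists>v'\<in>verts G'. f G' v' = f G v \<and> y = g G' v'"
  have "?P (g G v)" using Gv by blast
  then have "?P (SOME y. ?P y)" by (rule someI)
  then obtain G' v' where "G' \<in> \<G>" "v' \<in> verts G'" "f G' v' = f G v" "(SOME y. ?P y) = g G' v'"
    by blast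
  with eq[of G v G' v'] Gv show "g G v = (\<lambda>x. SOME y. \<exists>G'\<in>\<G>. \<exists>v'\<in>verts G'. f G' v' = x \<and> y = g G' v') (f G v)"
    by simp
qed

text \<open>The choice depends on the set only, so all nodes that know the set agree on the
  numbering of its elements.\<close>

definition list_of :: "'a set \<Rightarrow> 'a list" where
  "list_of S = (SOME xs. set xs = S \<and> distinct xs)"

lemma list_of:
  assumes "finite S"
  shows "set (list_of S) = S" "distinct (list_of S)" "length (list_of S) = card S"
proof -
  have "set (list_of S) = S \<and> distinct (list_of S)"
    unfolding list_of_def by (rule someI_ex) (rule finite_distinct_list[OF assms])
  then show "set (list_of S) = S" "distinct (list_of S)" "length (list_of S) = card S"
    by (auto simp flip: distinct_card)
qed

section \<open>Common knowledge and the roles of the nodes\<close>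

definition info :: "nat graph \<Rightarrow> nat \<times> nat \<times> (nat \<Rightarrow> nat) \<times> (nat \<Rightarrow> nat)" where
  "info G = (card (verts G), threshold G, core G, \<lambda>v. card (nbrs G v))"

text \<open>The cap by the number of vertices makes the maximum exist: for threshold
  \<open>0\<close>, every radius is feasible.\<close>

definition radius :: "nat graph \<Rightarrow> nat" where
  "radius G = (GREATEST \<rho>. \<rho> \<le> card (verts G) \<and> feasible (card (verts G)) (threshold G) \<rho>)"

definition part_count :: "nat graph \<Rightarrow> nat" where
  "part_count G = 6 * radius G * threshold G"

definition family :: "nat graph \<Rightarrow> nat \<Rightarrow> nat set set" where
  "family G l = small_subsets (part_count G) l"

text \<open>The number of paths that can be told to each vertex for each set \<open>Q\<close>, one
  per teller.\<close>

definition quota :: "nat graph \<Rightarrow> nat" where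
  "quota G = card (verts G) div card (family G (radius G))"

text \<open>The roles of a node \<open>y\<close> are the entries with index \<open>y\<close> of three lists. A teller \<open>(Q, j)\<close> informs
  every \<open>x\<close> of its \<open>j\<close>-th path with owners in \<open>Q\<close>; a collector \<open>(Q', Q, i)\<close> finds the paths with owners
  in \<open>Q'\<close> that start in the \<open>i\<close>-th center of \<open>Q\<close>; a detector \<open>Q\<close> looks for cycles with owners in \<open>Q\<close>.\<close>

definition tellers :: "nat graph \<Rightarrow> (nat set \<times> nat) list" where
  "tellers G = list_of (family G (radius G) \<times> {..<quota G})"

definition collectors :: "nat graph \<Rightarrow> (nat set \<times> nat set \<times> nat) list" where
  "collectors G = list_of (family G (3 * radius G) \<times> family G (radius G) \<times>
     {..<card (verts G) div quota G})"

definition detectors :: "nat graph \<Rightarrow> nat set list" where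
  "detectors G = list_of (family G (6 * radius G))"

text \<open>One gathering serves all three roles. A collector needs \<open>Q\<close> to identify the
  center and \<open>Q'\<close> to find the paths, so at most \<open>1 + 3 + 1 + 6\<close> times the
  radius many parts are involved.\<close>

definition assigned :: "nat graph \<Rightarrow> nat \<Rightarrow> nat set" where
  "assigned G y = (if y < length (tellers G) then fst (tellers G ! y) else {}) \<union>
     (if y < length (collectors G)
      then fst (collectors G ! y) \<union> fst (snd (collectors G ! y)) else {}) \<union>
     (if y < length (detectors G) then detectors G ! y else {})"

definition sources :: "nat graph \<Rightarrow> nat \<Rightarrow> nat set" where
  "sources G y = {u \<in> verts G. heavy G u \<or> u mod part_count G \<in> assigned G y}"

definition known :: "nat graph \<Rightarrow> nat \<Rightarrow> nat graph" where
  "known G y = \<lparr>verts = verts G, edges = {{u, v} |u v. u \<in> sources G y \<and> v \<in> owned G u}\<rparr>"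

lemma inputsD:
  assumes "G \<in> inputs"
  shows "simple_graph G" "verts G = {..<card (verts G)}" "2 \<le> card (verts G)" "0 < card (verts G)"
    "finite (verts G)"
  using assms unfolding inputs_def simple_graph_def by auto

lemma inputs_verts_iff: "G \<in> inputs \<Longrightarrow> v \<in> verts G \<longleftrightarrow> v < card (verts G)"
  using inputsD(2) by blast

lemma radius_max:
  assumes "\<rho> \<le> card (verts G)" "feasible (card (verts G)) (threshold G) \<rho>"
  shows "\<rho> \<le> radius G"
  unfolding radius_def using assms by (intro Greatest_le_nat[where b = "card (verts G)"]) auto

lemma feasible_radius:
  assumes "G \<in> inputs"
  shows "feasible (card (verts G)) (threshold G) (radius G)"
proof -
  let ?P = "\<lambda>\<rho>. \<rho> \<le> card (verts G) \<and> feasible (card (verts G)) (threshold G) \<rho>"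
  have "feasible (card (verts G)) (threshold G) 0"
    using inputsD(3)[OF assms] by (intro feasibleI) auto
  then have "?P 0" by simp
  then have "?P (GREATEST \<rho>. ?P \<rho>)"
    by (rule GreatestI_nat[where b = "card (verts G)"]) blast
  then show ?thesis unfolding radius_def by blast
qed

lemma family_bounds:
  assumes "G \<in> inputs"
  shows "part_count G \<le> card (verts G)" "card (family G (radius G)) \<le> card (verts G)"
    "card (family G (3 * radius G)) * (card (family G (radius G)) * (card (verts G) div quota G))
       \<le> card (verts G)"
    "card (family G (6 * radius G)) \<le> card (verts G)"
  using feasible_radius[OF assms] unfolding feasible_def Let_def family_def quota_def part_count_def
  by auto

lemma finite_family: "finite (family G l)"
  by (simp add: family_def finite_small_subsets)

lemma quota_pos:
  assumes "G \<in> inputs"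
  shows "0 < quota G"
proof -
  have "{} \<in> family G (radius G)" by (simp add: family_def small_subsets_def)
  then have "0 < card (family G (radius G))" using finite_family card_gt_0_iff by blast
  then show ?thesis
    using family_bounds(2)[OF assms] by (simp add: quota_def div_greater_zero_iff)
qed

lemma tellers:
  "set (tellers G) = family G (radius G) \<times> {..<quota G}"
  by (simp add: tellers_def list_of finite_family)

lemma collectors:
  "set (collectors G) = family G (3 * radius G) \<times> family G (radius G) \<times>
     {..<card (verts G) div quota G}" "distinct (collectors G)"
  by (simp_all add: collectors_def list_of finite_family)

lemma detectors: "set (detectors G) = family G (6 * radius G)"
  by (simp add: detectors_def list_of finite_family)

lemma length_roles_le:
  assumes "G \<in> inputs"
  shows "length (tellers G) \<le> card (verts G)" "length (collectors G) \<le> card (verts G)"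
    "length (detectors G) \<le> card (verts G)"
proof -
  show "length (tellers G) \<le> card (verts G)"
    by (simp add: tellers_def list_of finite_family card_cartesian_product quota_def)
  show "length (collectors G) \<le> card (verts G)"
    using family_bounds(3)[OF assms]
    by (simp add: collectors_def list_of finite_family card_cartesian_product)
  show "length (detectors G) \<le> card (verts G)"
    using family_bounds(4)[OF assms] by (simp add: detectors_def list_of finite_family)
qed

lemma assigned:
  "assigned G y \<subseteq> {..<part_count G}" "card (assigned G y) \<le> 11 * radius G"
proof -
  let ?r = "radius G"
  have sm: "Q \<subseteq> {..<part_count G} \<and> card Q \<le> l" if "Q \<in> family G l" for Q l
    using that by (auto simp: family_def small_subsets_def)
  define A where "A = (if y < length (tellers G) then fst (tellers G ! y) else {})"
  define B where "B = (if y < length (collectors G) then fst (collectors G ! y) else {})"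
  define C where "C = (if y < length (collectors G) then fst (snd (collectors G ! y)) else {})"
  define D where "D = (if y < length (detectors G) then detectors G ! y else {})"
  have A: "A \<subseteq> {..<part_count G} \<and> card A \<le> ?r"
  proof (cases "y < length (tellers G)")
    case True
    then have "fst (tellers G ! y) \<in> family G ?r" using tellers nth_mem by (metis mem_Times_iff)
    then show ?thesis using sm True by (simp add: A_def)
  qed (simp add: A_def)
  have BC: "B \<subseteq> {..<part_count G} \<and> card B \<le> 3 * ?r \<and> C \<subseteq> {..<part_count G} \<and> card C \<le> ?r"
  proof (cases "y < length (collectors G)")
    case True
    then have "collectors G ! y \<in> family G (3 * ?r) \<times> family G ?r \<times> {..<card (verts G) div quota G}"
      using collectors(1) nth_mem by blast
    then have "fst (collectors G ! y) \<in> family G (3 * ?r)" "fst (snd (collectors G ! y)) \<in> family G ?r"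
      by (auto simp: mem_Times_iff)
    then show ?thesis using sm True by (simp add: B_def C_def)
  qed (simp add: B_def C_def)
  have D: "D \<subseteq> {..<part_count G} \<and> card D \<le> 6 * ?r"
  proof (cases "y < length (detectors G)")
    case True
    then have "detectors G ! y \<in> family G (6 * ?r)" using detectors nth_mem by blast
    then show ?thesis using sm True by (simp add: D_def)
  qed (simp add: D_def)
  have eq: "assigned G y = A \<union> B \<union> C \<union> D"
    by (auto simp: assigned_def A_def B_def C_def D_def)
  then show "assigned G y \<subseteq> {..<part_count G}" using A BC D by blast
  have "card (A \<union> B \<union> C \<union> D) \<le> card A + card B + card C + card D"
    by (meson card_Un_le add_le_mono1 order_trans)
  then show "card (assigned G y) \<le> 11 * ?r" unfolding eq using A BC D by linarith
qed

lemma card_residue_le: "card {u. u < n \<and> u mod P = i} \<le> n div P + 1" for n P i :: nat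
proof -
  have "card {u. u < n \<and> u mod P = i} \<le> card {..n div P}"
  proof (rule card_inj_on_le[of "\<lambda>u. u div P"])
    show "inj_on (\<lambda>u. u div P) {u. u < n \<and> u mod P = i}"
      by (rule inj_onI) (metis (mono_tags) div_mult_mod_eq mem_Collect_eq)
  qed (auto intro: div_le_mono)
  then show ?thesis by simp
qed

text \<open>The heavy vertices own at most \<open>20736 * n\<close> edges by the choice of the
  threshold. Each light source owns at most \<open>threshold G\<close>, and the assigned parts have
  about \<open>n div part_count G\<close> vertices each.\<close>

lemma sum_owned_sources_le:
  assumes "G \<in> inputs"
  shows "(\<Sum>u\<in>sources G y. card (owned G u)) \<le> 20740 * card (verts G)"
proof -
  note G = inputsD[OF assms]
  let ?n = "card (verts G)" and ?t = "threshold G" and ?P = "part_count G"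
  have arith: "a \<le> c \<Longrightarrow> b \<le> c \<Longrightarrow> 2 * (a + b) \<le> 4 * c" for a b c :: nat by simp
  define L where "L = {u \<in> verts G. \<not> heavy G u \<and> u mod ?P \<in> assigned G y}"
  have fin: "finite L" "finite {u \<in> verts G. heavy G u}" using G(5) by (auto simp: L_def)
  have "(\<Sum>u\<in>sources G y. card (owned G u))
      = (\<Sum>u\<in>{u \<in> verts G. heavy G u}. card (owned G u)) + (\<Sum>u\<in>L. card (owned G u))"
    using fin by (subst sum.union_disjoint[symmetric]) (auto simp: L_def sources_def intro!: sum.cong)
  moreover have "(\<Sum>u\<in>{u \<in> verts G. heavy G u}. card (owned G u)) \<le> 20736 * ?n"
    using threshold[OF G(1)] by (simp add: owned_def owns_def out_bound_def)
  moreover have "(\<Sum>u\<in>L. card (owned G u)) \<le> 4 * ?n"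
  proof -
    have "(\<Sum>u\<in>L. card (owned G u)) \<le> (\<Sum>u\<in>L. ?t)"
      by (intro sum_mono card_owned_light[OF G(1)]) (simp add: L_def)
    also have "\<dots> = card L * ?t" by simp
    also have "\<dots> \<le> 4 * ?n"
    proof (cases "?P = 0")
      case True
      then have "assigned G y = {}" using assigned(1)[of G y] by auto
      then show ?thesis by (simp add: L_def)
    next
      case False
      have fA: "finite (assigned G y)" using assigned(1) finite_subset by blast
      have "L \<subseteq> (\<Union>i\<in>assigned G y. {u. u < ?n \<and> u mod ?P = i})"
        using G(2) by (auto simp: L_def)
      then have "card L \<le> card (\<Union>i\<in>assigned G y. {u. u < ?n \<and> u mod ?P = i})"
        by (intro card_mono) (use fA in auto)
      also have "\<dots> \<le> (\<Sum>i\<in>assigned G y. card {u. u < ?n \<and> u mod ?P = i})"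
        by (rule card_UN_le[OF fA])
      also have "\<dots> \<le> (\<Sum>i\<in>assigned G y. ?n div ?P + 1)" by (intro sum_mono card_residue_le)
      also have "\<dots> = card (assigned G y) * (?n div ?P + 1)" by simp
      \<comment> \<open>The factor \<open>11\<close> is rounded up to \<open>12\<close> because
        \<open>12 * radius G * threshold G\<close> is twice the number of parts.\<close>
      also have "\<dots> \<le> (12 * radius G) * (?n div ?P + 1)"
        using assigned(2)[of G y] by (intro mult_right_mono) auto
      finally have "card L * ?t \<le> (12 * radius G) * (?n div ?P + 1) * ?t" by (rule mult_right_mono) simp
      also have "\<dots> = 2 * (?P * (?n div ?P) + ?P)" by (simp add: part_count_def algebra_simps)
      also have "\<dots> \<le> 4 * ?n"
        using arith[OF times_div_less_eq_dividend family_bounds(1)[OF assms]] .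
      finally show ?thesis .
    qed
    finally show ?thesis .
  qed
  ultimately show ?thesis by linarith
qed

text \<open>What \<open>info\<close> determines is common knowledge as soon as \<open>info\<close>
  is. In particular all nodes agree on the roles without any communication about them.\<close>

lemma info_cong:
  assumes "info G = info G'"
  shows "card (verts G) = card (verts G')" "threshold G = threshold G'" "core G = core G'"
    "heavy G = heavy G'" "owns G = owns G'" "owner G = owner G'" "radius G = radius G'"
    "part_count G = part_count G'" "family G = family G'" "quota G = quota G'"
    "tellers G = tellers G'" "collectors G = collectors G'" "detectors G = detectors G'"
    "assigned G = assigned G'"
proof -
  show n: "card (verts G) = card (verts G')" and t: "threshold G = threshold G'"
    and c: "core G = core G'" using assms by (auto simp: info_def)
  show h: "heavy G = heavy G'" by (simp add: heavy_def fun_eq_iff t c)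
  show o: "owns G = owns G'" using assms by (simp add: info_def owns_def h fun_eq_iff)
  show "owner G = owner G'" by (simp add: owner_def o fun_eq_iff)
  show r: "radius G = radius G'" by (simp add: radius_def n t)
  show p: "part_count G = part_count G'" by (simp add: part_count_def r t)
  show f: "family G = family G'" by (simp add: family_def p fun_eq_iff)
  show q: "quota G = quota G'" by (simp add: quota_def f n r)
  show t: "tellers G = tellers G'" by (simp add: tellers_def f r q)
  show co: "collectors G = collectors G'" by (simp add: collectors_def f r q n)
  show d: "detectors G = detectors G'" by (simp add: detectors_def f r)
  show "assigned G = assigned G'" by (simp add: assigned_def t co d fun_eq_iff)
qed

lemma info_verts:
  assumes "info G = info G'" "G \<in> inputs" "G' \<in> inputs"
  shows "verts G = verts G'"
  using inputsD(2)[OF assms(2)] inputsD(2)[OF assms(3)] info_cong(1)[OF assms(1)] by simp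

lemma learnable_id: "learnable \<G> (\<lambda>G v. v)"
  by (rule learnable_map[OF learnable_local, where h = "\<lambda>(n, v, E). v"]) simp

lemma learnable_nbrs: "learnable \<G> nbrs"
  by (rule learnable_map[OF learnable_local, where h = "\<lambda>(n, v, E). {u. {v, u} \<in> E}"])
    (simp add: nbrs_def)

text \<open>The default \<open>0\<close> for non-vertices is the true value here, so the nodes learn
  the whole function.\<close>

lemma learnable_broadcast_vanishing:
  assumes "learnable inputs f" "\<And>G u. G \<in> inputs \<Longrightarrow> u \<in> verts G \<Longrightarrow> f G u < card (verts G)"
    "\<And>G u. G \<in> inputs \<Longrightarrow> u \<notin> verts G \<Longrightarrow> f G u = 0"
  shows "learnable inputs (\<lambda>G v. f G)"
proof (rule learnable_map[where h = "\<lambda>x. x"])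
  show "learnable inputs (\<lambda>G v u. if u \<in> verts G then f G u else 0)"
    by (rule learnable_broadcast[OF assms(1), where k = 1]) (simp add: assms(2))
qed (use assms(3) in \<open>auto simp: fun_eq_iff\<close>)

text \<open>Broadcast degrees determine the cores, broadcast cores determine
  \<open>out_bound\<close>, and from its broadcast everybody computes the threshold.\<close>

lemma learnable_info: "learnable inputs (\<lambda>G v. info G)"
proof -
  note n = learnable_map[OF learnable_local, where h = fst and f' = "\<lambda>G v. card (verts G)", simplified]
  have "learnable inputs (\<lambda>G v. card (nbrs G v))"
    by (rule learnable_map[OF learnable_nbrs, where h = card]) simp
  then have d: "learnable inputs (\<lambda>G v u. card (nbrs G u))"
    by (rule learnable_broadcast_vanishing)
      (auto dest: inputsD intro: card_nbrs_less simp: nbrs_empty)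
  have "learnable inputs core"
    by (rule learnable_map[OF learnable_pair[OF n learnable_pair[OF learnable_nbrs d]],
      where h = "\<lambda>(n, S, d). card {t \<in> {1..n}. t \<le> card {u \<in> S. t \<le> d u}}"]) (simp add: core_def)
  then have c: "learnable inputs (\<lambda>G v. core G)"
  proof (rule learnable_broadcast_vanishing)
    fix G and u :: nat assume G: "G \<in> inputs"
    note le = core_le[OF inputsD(1)[OF G], of u]
    show "core G u < card (verts G)" if "u \<in> verts G"
      using le card_nbrs_less[OF inputsD(1)[OF G] that] by linarith
    show "core G u = 0" if "u \<notin> verts G"
      using le nbrs_empty[OF inputsD(1)[OF G] that] by simp
  qed
  have "learnable inputs out_bound"
    by (rule learnable_map[OF learnable_pair[OF learnable_id learnable_pair[OF learnable_nbrs c]],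
      where h = "\<lambda>(v, S, c). card {u \<in> S. c v \<le> c u}"]) (simp add: out_bound_def)
  then have o: "learnable inputs (\<lambda>G v. out_bound G)"
  proof (rule learnable_broadcast_vanishing)
    fix G and u :: nat assume G: "G \<in> inputs"
    have le: "out_bound G u \<le> card (nbrs G u)"
      unfolding out_bound_def using finite_nbrs[OF inputsD(1)[OF G]] by (intro card_mono) auto
    show "out_bound G u < card (verts G)" if "u \<in> verts G"
      using le card_nbrs_less[OF inputsD(1)[OF G] that] by linarith
    show "out_bound G u = 0" if "u \<notin> verts G"
      using le nbrs_empty[OF inputsD(1)[OF G] that] by simp
  qed
  show ?thesis
  proof (rule learnable_map[OF learnable_pair[OF n learnable_pair[OF d learnable_pair[OF c o]]],
      where h = "\<lambda>(n, d, c, o'). (n,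
        LEAST t. (\<Sum>v\<in>{v \<in> {..<n}. t < c v}. o' v) \<le> 20736 * n, c, d)"])
    fix G and v :: nat assume "G \<in> inputs"
    then have "{..<card (verts G)} = verts G" using inputsD(2) by blast
    then show "info G = (\<lambda>(n, d, c, o'). (n,
        LEAST t. (\<Sum>v\<in>{v \<in> {..<n}. t < c v}. o' v) \<le> 20736 * n, c, d))
        (card (verts G), \<lambda>u. card (nbrs G u), core G, out_bound G)"
      by (simp only: info_def threshold_def prod.case)
  qed
qed

text \<open>A vertex finds the edges it owns from common knowledge and its neighbors, and a node
  finds its sources from common knowledge. Fetching then applies with
  \<open>20740 = 20736 + 4\<close>.\<close>

lemma learnable_known: "learnable inputs known"
proof -
  have "learnable inputs owned"
  proof (rule learnable_factor[OF learnable_pair[OF learnable_info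
        learnable_pair[OF learnable_id learnable_nbrs]]])
    fix G v G' v' assume "(info G, v :: nat, nbrs G v) = (info G', v', nbrs G' v')"
    then have "info G = info G'" "nbrs G v = nbrs G' v'" "v = v'" by auto
    then show "owned G v = owned G' v'" unfolding owned_def using info_cong(5)[of G G'] by auto
  qed
  then have own: "learnable inputs (\<lambda>G u. list_of (owned G u))"
    by (rule learnable_map[where h = list_of]) simp
  have src: "learnable inputs sources"
  proof (rule learnable_factor[OF learnable_pair[OF learnable_info learnable_id]])
    fix G v G' v' assume G: "G \<in> inputs" "G' \<in> inputs" and "(info G, v :: nat) = (info G', v')"
    then have i: "info G = info G'" "v = v'" by auto
    have "verts G = verts G'" by (rule info_verts[OF i(1) G])
    with i show "sources G v = sources G' v'"
      unfolding sources_def using info_cong[OF i(1)] by simp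
  qed
  have lo: "set (list_of (owned G u)) = owned G u \<and> length (list_of (owned G u)) = card (owned G u)"
    if "G \<in> inputs" for G u
    using finite_owned[OF inputsD(1)[OF that]] list_of by blast
  have "learnable inputs (\<lambda>G y u. if u \<in> sources G y then list_of (owned G u) else [])"
  proof (rule learnable_fetch[OF order_refl own src, where k = 1 and C = 20740])
    fix G and u :: nat assume G: "G \<in> inputs" "u \<in> verts G"
    have sub: "owned G u \<subseteq> nbrs G u" by (auto simp: owned_def)
    have "card (owned G u) \<le> card (nbrs G u)"
      using sub finite_nbrs[OF inputsD(1)[OF G(1)]] by (intro card_mono)
    with card_nbrs_less[OF inputsD(1)[OF G(1)] G(2)]
    show "length (list_of (owned G u)) < card (verts G) ^ 1" by (simp add: lo[OF G(1)])
    show "w < card (verts G) ^ 1" if "w \<in> set (list_of (owned G u))" for w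
    proof -
      have "w \<in> verts G" using that sub nbrs_subset[OF inputsD(1)[OF G(1)], of u] lo[OF G(1)] by auto
      then show ?thesis using inputs_verts_iff[OF G(1)] by simp
    qed
    show "sources G u \<subseteq> verts G" by (auto simp: sources_def)
    show "(\<Sum>w\<in>sources G u. length (list_of (owned G w))) \<le> 20740 * card (verts G)"
      using sum_owned_sources_le[OF G(1)] by (simp add: lo[OF G(1)])
  qed
  from learnable_pair[OF learnable_local learnable_pair[OF src this]] show ?thesis
  proof (rule learnable_map[where h = "\<lambda>((n, _), S, F).
      \<lparr>verts = {..<n}, edges = {{u, v} |u v. u \<in> S \<and> v \<in> set (F u)}\<rparr>"])
    fix G y assume G: "G \<in> inputs"
    show "known G y = (\<lambda>((n, _), S, F). \<lparr>verts = {..<n}, edges = {{u, v} |u v. u \<in> S \<and> v \<in> set (F u)}\<rparr>)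
      ((card (verts G), y, {e \<in> edges G. y \<in> e}), sources G y,
       \<lambda>u. if u \<in> sources G y then list_of (owned G u) else [])"
      by (simp add: known_def lo[OF G] inputsD(2)[OF G, symmetric] cong: conj_cong)
  qed
qed

section \<open>Detecting short cycles\<close>

definition owners :: "nat graph \<Rightarrow> nat list \<Rightarrow> nat set" where
  "owners G p = (\<lambda>(a, b). owner G a b) ` set (zip p (tl p))"

text \<open>The parts a node must be assigned to see all edges of \<open>p\<close>; heavy owners are
  omitted because everybody knows their edges.\<close>

definition trace :: "nat graph \<Rightarrow> nat list \<Rightarrow> nat set" where
  "trace G p = (\<lambda>w. w mod part_count G) ` {w \<in> owners G p. \<not> heavy G w}"

lemma successively_zip: "successively P xs \<longleftrightarrow> (\<forall>(a, b)\<in>set (zip xs (tl xs)). P a b)"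
  by (induction P xs rule: successively.induct) auto

lemma walk_edge: "walk G p \<Longrightarrow> (a, b) \<in> set (zip p (tl p)) \<Longrightarrow> {a, b} \<in> edges G"
  by (auto simp: walk_def successively_zip)

lemma card_trace_le: "card (trace G p) \<le> length p - 1"
proof -
  have "card (trace G p) \<le> card {w \<in> owners G p. \<not> heavy G w}"
    unfolding trace_def owners_def by (rule card_image_le) simp
  also have "\<dots> \<le> card (owners G p)" unfolding owners_def by (intro card_mono) auto
  also have "\<dots> \<le> card (set (zip p (tl p)))" unfolding owners_def by (rule card_image_le) simp
  also have "\<dots> \<le> length (zip p (tl p))" by (rule card_length)
  finally show ?thesis by simp
qed

lemma trace_subset:
  assumes G: "G \<in> inputs" and w: "walk G p" and r: "0 < radius G"
  shows "trace G p \<subseteq> {..<part_count G}"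
proof
  fix i assume "i \<in> trace G p"
  then obtain a b where ab: "(a, b) \<in> set (zip p (tl p))" "\<not> heavy G (owner G a b)"
      "i = owner G a b mod part_count G"
    by (auto simp: trace_def owners_def)
  have "{a, b} \<in> edges G" using walk_edge[OF w ab(1)] .
  then have "owned G (owner G a b) \<noteq> {}"
    using owner_owned[OF inputsD(1)[OF G], of a b] by force
  then have "0 < card (owned G (owner G a b))"
    using finite_owned[OF inputsD(1)[OF G]] by (simp add: card_gt_0_iff)
  \<comment> \<open>A light owner owns an edge, so the threshold is positive. Hence the number of
    parts is positive too and the residue is below it.\<close>
  then have "0 < threshold G"
    using card_owned_light[OF inputsD(1)[OF G] ab(2)] by linarith
  then show "i \<in> {..<part_count G}" using r by (simp add: ab(3) part_count_def)
qed

lemma trace_in_family: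
  assumes "G \<in> inputs" "walk G p" "length p \<le> Suc l" "0 < radius G"
  shows "trace G p \<in> family G l"
  using trace_subset[OF assms(1,2,4)] card_trace_le[of G p] assms(3)
  by (simp add: family_def small_subsets_def)

lemma subgraph_known:
  assumes "G \<in> inputs"
  shows "subgraph (known G y) G"
  by (auto simp: subgraph_def known_def owned_def nbrs_def)

lemma walk_subgraph: "subgraph H G \<Longrightarrow> walk H p \<Longrightarrow> walk G p"
  unfolding walk_def subgraph_def successively_zip by fast

lemma known_edge:
  assumes G: "G \<in> inputs" and e: "{a, b} \<in> edges G"
    and s: "heavy G (owner G a b) \<or> owner G a b mod part_count G \<in> assigned G y"
  shows "{a, b} \<in> edges (known G y)"
proof -
  have V: "a \<in> verts G" "b \<in> verts G" using simple_graph_edgeD[OF inputsD(1)[OF G] e] by auto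
  then have "owner G a b \<in> sources G y" using s by (auto simp: sources_def owner_def)
  moreover obtain v where v: "v \<in> owned G (owner G a b)" "{a, b} = {owner G a b, v}"
    using owner_owned[OF inputsD(1)[OF G] e] by (metis insert_commute)
  ultimately have "{owner G a b, v} \<in> edges (known G y)" unfolding known_def by auto
  then show ?thesis by (simp only: v(2))
qed

lemma walk_known:
  assumes G: "G \<in> inputs" and w: "walk G p" and t: "trace G p \<subseteq> assigned G y"
  shows "walk (known G y) p"
proof -
  have "{a, b} \<in> edges (known G y)" if ab: "(a, b) \<in> set (zip p (tl p))" for a b
  proof (rule known_edge[OF G walk_edge[OF w ab]])
    show "heavy G (owner G a b) \<or> owner G a b mod part_count G \<in> assigned G y"
    proof (rule disjCI)
      assume "owner G a b mod part_count G \<notin> assigned G y"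
      moreover have "owner G a b \<in> owners G p" using ab unfolding owners_def by force
      ultimately show "heavy G (owner G a b)" using t unfolding trace_def by blast
    qed
  qed
  then show ?thesis using w by (auto simp: walk_def successively_zip known_def)
qed

text \<open>Equality instead of inclusion makes these sets disjoint for different \<open>Q\<close>,
  so no path is collected twice.\<close>

definition traced :: "nat graph \<Rightarrow> nat \<Rightarrow> nat \<Rightarrow> nat set \<Rightarrow> nat list set" where
  "traced G x l Q = {p \<in> paths_from G x l. trace G p = Q}"

text \<open>A node holding the parts \<open>Q\<close> sees all these paths, and it sees no false
  ones since its graph is a subgraph. Hence it can compute the set.\<close>

lemma traced_known:
  assumes "G \<in> inputs" "Q \<subseteq> assigned G y"
  shows "traced G x l Q = {p \<in> paths_from (known G y) x l. trace G p = Q}"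
  using assms walk_known[OF assms(1)] walk_subgraph[OF subgraph_known[OF assms(1)]]
  unfolding traced_def paths_from_def by blast

lemma trace_cong:
  assumes "info G = info G'"
  shows "trace G = trace G'"
  unfolding trace_def owners_def info_cong[OF assms] ..

lemma traced_cong:
  assumes "G \<in> inputs" "G' \<in> inputs" "info G = info G'" "known G y = known G' y" "Q \<subseteq> assigned G y"
  shows "traced G x l Q = traced G' x l Q"
proof -
  have "Q \<subseteq> assigned G' y" using assms(5) info_cong(14)[OF assms(3)] by simp
  then show ?thesis
    using assms by (simp add: traced_known trace_cong[OF assms(3)])
qed

lemma finite_traced: "G \<in> inputs \<Longrightarrow> finite (traced G x l Q)"
  unfolding traced_def using finite_paths_from[OF inputsD(5)] by simp

text \<open>\<open>0\<close> encodes the absence of cycles, as no cycle has length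
  \<open>0\<close>.\<close>

definition shortest :: "nat graph \<Rightarrow> nat \<Rightarrow> nat" where
  "shortest G y = (case girth (known G y) of enat k \<Rightarrow> k | \<infinity> \<Rightarrow> 0)"

definition detected :: "nat graph \<Rightarrow> nat set" where
  "detected G = {k. 0 < k \<and> k \<le> 6 * radius G \<and> (\<exists>y\<in>verts G. shortest G y = k)}"

lemma cycle_length_le:
  assumes "cycle G c" "finite (verts G)"
  shows "length c \<le> card (verts G)"
  using assms by (metis card_mono cycle_def distinct_card walk_def)

lemma learnable_detected: "learnable inputs (\<lambda>G v. detected G)"
proof -
  have "learnable inputs shortest"
    by (rule learnable_map[OF learnable_known, where h = "\<lambda>H. case girth H of enat k \<Rightarrow> k | \<infinity> \<Rightarrow> 0"])
      (simp add: shortest_def)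
  then have "learnable inputs (\<lambda>G v y. if y \<in> verts G then shortest G y else 0)"
  proof (rule learnable_broadcast[where k = 2])
    fix G and y :: nat assume G: "G \<in> inputs"
    have "shortest G y \<le> card (verts G)"
    proof (cases "girth (known G y)")
      case (enat k)
      then obtain c where "cycle (known G y) c" "length c = k" using girth_attained by blast
      then have "k \<le> card (verts (known G y))"
        using cycle_length_le[of "known G y" c] inputsD(5)[OF G] by (simp add: known_def)
      then show ?thesis using enat by (simp add: shortest_def known_def)
    qed (simp add: shortest_def)
    also have "\<dots> < card (verts G) ^ 2"
      using inputsD(3)[OF G] by (simp add: power2_eq_square)
    finally show "shortest G y < card (verts G) ^ 2" .
  qed
  from learnable_pair[OF learnable_info this] show ?thesis
  proof (rule learnable_factor)
    fix G v G' v'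
    assume G: "G \<in> inputs" "G' \<in> inputs" and "(info G, \<lambda>y. if y \<in> verts G then shortest G y else 0)
      = (info G', \<lambda>y. if y \<in> verts G' then shortest G' y else 0)"
    then have i: "info G = info G'"
      and s: "(\<lambda>y. if y \<in> verts G then shortest G y else 0) = (\<lambda>y. if y \<in> verts G' then shortest G' y else 0)"
      by simp_all
    have V: "verts G = verts G'" by (rule info_verts[OF i G])
    have "shortest G y = shortest G' y" if "y \<in> verts G'" for y
      using fun_cong[OF s, of y] that V by simp
    then show "detected G = detected G'"
      unfolding detected_def V info_cong(7)[OF i] by auto
  qed
qed

lemma nth_role:
  assumes "length xs \<le> card (verts G)" "G \<in> inputs" "a \<in> set xs"
  shows "\<exists>y\<in>verts G. y < length xs \<and> xs ! y = a"
  using assms by (metis in_set_conv_nth inputs_verts_iff less_le_trans)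

lemma cycle_subgraph: "subgraph H G \<Longrightarrow> cycle H c \<Longrightarrow> cycle G c"
  unfolding cycle_def using walk_subgraph[of H G c] by (auto simp: subgraph_def)

text \<open>Cycles in known subgraphs are cycles of \<open>G\<close>, so no value is below
  \<open>g\<close>. If \<open>g\<close> is small enough, some detector is assigned all parts that a
  shortest cycle needs.\<close>

lemma detected_girth:
  assumes G: "G \<in> inputs" and g: "girth G = enat g"
  shows "if g \<le> 6 * radius G then detected G \<noteq> {} \<and> Min (detected G) = g else detected G = {}"
proof -
  have ge: "g \<le> k" if k: "girth (known G y) = enat k" for y k
  proof -
    obtain c where "cycle (known G y) c" "length c = k" using girth_attained[OF k] by blast
    then show ?thesis using girth_le[OF cycle_subgraph[OF subgraph_known[OF G]]] g by force
  qed
  have all_ge: "g \<le> k" if "k \<in> detected G" for k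
    using that ge by (auto simp: detected_def shortest_def split: enat.splits)
  show ?thesis
  proof (cases "g \<le> 6 * radius G")
    case True
    obtain c where c: "cycle G c" "length c = g" using girth_attained[OF g] by blast
    then have "3 \<le> g" by (auto simp: cycle_def)
    with True have r: "0 < radius G" by auto
    \<comment> \<open>Repeating the first vertex turns the closing edge into an edge of the walk, so
      the trace covers its owner as well. The walk has \<open>g\<close> edges.\<close>
    let ?p = "c @ [hd c]"
    have w: "walk G ?p" using c(1) by (auto simp: cycle_def walk_append walk_def[of G "[hd c]"] walk_def[of G c])
    have "trace G ?p \<in> set (detectors G)"
      using trace_in_family[OF G w _ r] c(2) True by (simp add: detectors)
    then obtain y where y: "y \<in> verts G" "y < length (detectors G)" "detectors G ! y = trace G ?p"
      using nth_role[OF length_roles_le(3)[OF G] G] by blast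
    have "trace G ?p \<subseteq> assigned G y" unfolding assigned_def using y(2,3) by simp
    from walk_known[OF G w this] have "walk (known G y) ?p" .
    then have "cycle (known G y) c"
      using c(1) by (auto simp: cycle_def walk_append split: if_splits)
    from girth_le[OF this] c(2) obtain k where k: "girth (known G y) = enat k" "k \<le> g"
      by (cases "girth (known G y)") auto
    with ge[OF k(1)] have "shortest G y = g" by (simp add: shortest_def)
    with y(1) True \<open>3 \<le> g\<close> have "g \<in> detected G" by (auto simp: detected_def)
    moreover have "finite (detected G)"
      by (rule finite_subset[of _ "{..6 * radius G}"]) (auto simp: detected_def)
    ultimately have "Min (detected G) = g" using all_ge by (intro Min_eqI) auto
    with \<open>g \<in> detected G\<close> True show ?thesis by auto
  next
    case False
    then show ?thesis using all_ge by (force simp: detected_def)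
  qed
qed

section \<open>Learning the neighborhoods\<close>

definition large_girth :: "nat graph set" where
  "large_girth = {G \<in> inputs. enat (6 * radius G) < girth G}"

definition centers_of :: "('a \<Rightarrow> 'b set) \<Rightarrow> 'a set \<Rightarrow> 'a set" where
  "centers_of f A = (SOME M. M \<subseteq> A \<and> disjoint_family_on f M \<and> (\<forall>x\<in>A. \<exists>c\<in>M. f x \<inter> f c \<noteq> {}))"

text \<open>Greedy choice: \<open>a\<close> joins \<open>M\<close> unless its set meets that of an
  earlier member. If it joins, it is covered by itself because its set is nonempty.\<close>

lemma centers_of:
  assumes "finite A" "\<And>x. x \<in> A \<Longrightarrow> f x \<noteq> {}"
  shows "centers_of f A \<subseteq> A" "disjoint_family_on f (centers_of f A)"
    "\<And>x. x \<in> A \<Longrightarrow> \<exists>c\<in>centers_of f A. f x \<inter> f c \<noteq> {}"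
proof -
  have "\<exists>M. M \<subseteq> A \<and> disjoint_family_on f M \<and> (\<forall>x\<in>A. \<exists>c\<in>M. f x \<inter> f c \<noteq> {})"
    using assms
  proof (induction A rule: finite_induct)
    case empty
    show ?case by (intro exI[of _ "{}"]) (auto simp: disjoint_family_on_def)
  next
    case (insert a A)
    then obtain M where M: "M \<subseteq> A" "disjoint_family_on f M" "\<forall>x\<in>A. \<exists>c\<in>M. f x \<inter> f c \<noteq> {}"
      by auto
    show ?case
    proof (cases "\<exists>c\<in>M. f a \<inter> f c \<noteq> {}")
      case True
      with M show ?thesis by (intro exI[of _ M]) auto
    next
      case False
      with M(2) have "disjoint_family_on f (insert a M)"
        unfolding disjoint_family_on_def by (metis Int_commute insert_iff)
      with M(1,3) insert.prems show ?thesis by (intro exI[of _ "insert a M"]) auto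
    qed
  qed
  from someI_ex[OF this] show "centers_of f A \<subseteq> A" "disjoint_family_on f (centers_of f A)"
    "\<And>x. x \<in> A \<Longrightarrow> \<exists>c\<in>centers_of f A. f x \<inter> f c \<noteq> {}"
    unfolding centers_of_def by blast+
qed

definition crowded :: "nat graph \<Rightarrow> nat set \<Rightarrow> nat \<Rightarrow> bool" where
  "crowded G Q x \<longleftrightarrow> quota G < card (traced G x (radius G) Q)"

definition ends :: "nat graph \<Rightarrow> nat set \<Rightarrow> nat \<Rightarrow> nat set" where
  "ends G Q x = last ` traced G x (radius G) Q"

text \<open>The fixed order gives the \<open>i\<close>-th center the same meaning for all nodes in
  charge of \<open>Q\<close>.\<close>

definition centers :: "nat graph \<Rightarrow> nat set \<Rightarrow> nat list" where
  "centers G Q = list_of (centers_of (ends G Q) {x \<in> verts G. crowded G Q x})"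

text \<open>Only the last edge of a path is transmitted.\<close>

definition code :: "nat graph \<Rightarrow> nat list \<Rightarrow> nat" where
  "code G p = last (butlast p) * card (verts G) + last p"

definition decode :: "nat graph \<Rightarrow> nat \<Rightarrow> nat set" where
  "decode G w = {w div card (verts G), w mod card (verts G)}"

text \<open>Hints are shifted by one, so that \<open>0\<close> means that there is nothing to
  tell.\<close>

definition edge_hint :: "nat graph \<Rightarrow> nat \<Rightarrow> nat \<Rightarrow> nat" where
  "edge_hint G y x = (if y < length (tellers G) then
     let ps = list_of (traced G x (radius G) (fst (tellers G ! y))); j = snd (tellers G ! y)
     in if j < length ps then Suc (code G (ps ! j)) else 0 else 0)"

definition center_hint :: "nat graph \<Rightarrow> nat \<Rightarrow> nat \<Rightarrow> nat" where
  "center_hint G y x = (if y < length (tellers G) \<and> crowded G (fst (tellers G ! y)) x then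
     let Q = fst (tellers G ! y)
     in Suc (LEAST i. i < length (centers G Q) \<and> ends G Q x \<inter> ends G Q (centers G Q ! i) \<noteq> {})
     else 0)"

text \<open>The ball of a single center contains everything \<open>x\<close> needs, so
  \<open>x\<close> follows only the first center hint. The requested collectors share
  \<open>Q\<close> and \<open>i\<close> and differ in \<open>Q'\<close>.\<close>

definition requested :: "nat graph \<Rightarrow> nat \<Rightarrow> nat set" where
  "requested G x = (if \<exists>y\<in>verts G. 0 < center_hint G y x then
     let y = (LEAST y. y \<in> verts G \<and> 0 < center_hint G y x)
     in {z \<in> verts G. z < length (collectors G) \<and>
          snd (collectors G ! z) = (fst (tellers G ! y), center_hint G y x - 1)}
     else {})"

definition collected :: "nat graph \<Rightarrow> nat \<Rightarrow> nat list" where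
  "collected G z = (if z < length (collectors G) then
     let (Q', Q, i) = collectors G ! z
     in if i < length (centers G Q)
        then map (code G) (list_of (traced G (centers G Q ! i) (3 * radius G) Q')) else []
     else [])"

definition codes :: "nat graph \<Rightarrow> nat \<Rightarrow> nat set" where
  "codes G x = {w. \<exists>y\<in>verts G. edge_hint G y x = Suc w} \<union> (\<Union>z\<in>requested G x. set (collected G z))"

definition answer :: "nat graph \<Rightarrow> nat \<Rightarrow> girth_result" where
  "answer G x = Known_Subgraph \<lparr>verts = verts G, edges = decode G ` codes G x\<rparr>"

lemma large_girthD:
  assumes "G \<in> large_girth"
  shows "G \<in> inputs" "enat (2 * (3 * radius G)) < girth G" "enat (2 * radius G) < girth G"
proof -
  show "G \<in> inputs" "enat (2 * (3 * radius G)) < girth G"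
    using assms by (simp_all add: large_girth_def)
  moreover have "enat (2 * radius G) \<le> enat (2 * (3 * radius G))" by simp
  ultimately show "enat (2 * radius G) < girth G" by (meson le_less_trans)
qed

lemma centers:
  assumes "G \<in> inputs"
  shows "set (centers G Q) \<subseteq> verts G" "disjoint_family_on (ends G Q) (set (centers G Q))"
    "\<And>x. x \<in> set (centers G Q) \<Longrightarrow> crowded G Q x" "distinct (centers G Q)"
    "\<And>x. x \<in> verts G \<Longrightarrow> crowded G Q x \<Longrightarrow>
      \<exists>i<length (centers G Q). ends G Q x \<inter> ends G Q (centers G Q ! i) \<noteq> {}"
proof -
  let ?A = "{x \<in> verts G. crowded G Q x}"
  have A: "finite ?A" using inputsD(5)[OF assms] by simp
  have ne: "ends G Q x \<noteq> {}" if "x \<in> ?A" for x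
    using that by (auto simp: crowded_def ends_def)
  note c = centers_of[where f = "ends G Q", OF A ne]
  have "finite (centers_of (ends G Q) ?A)" using c(1) A finite_subset by blast
  from list_of[OF this] have s: "set (centers G Q) = centers_of (ends G Q) ?A"
    and "distinct (centers G Q)" by (simp_all add: centers_def)
  then show "distinct (centers G Q)" by simp
  show "set (centers G Q) \<subseteq> verts G" "disjoint_family_on (ends G Q) (set (centers G Q))"
    "\<And>x. x \<in> set (centers G Q) \<Longrightarrow> crowded G Q x"
    using c(1,2) unfolding s by auto
  fix x assume "x \<in> verts G" "crowded G Q x"
  then obtain b where "b \<in> set (centers G Q)" "ends G Q x \<inter> ends G Q b \<noteq> {}"
    using c(3)[of x] unfolding s by blast
  then show "\<exists>i<length (centers G Q). ends G Q x \<inter> ends G Q (centers G Q ! i) \<noteq> {}"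
    by (metis in_set_conv_nth)
qed

text \<open>By the girth, different paths from a vertex have different ends, so each center has at
  least \<open>quota G\<close> ends. These sets of ends are disjoint for different centers.\<close>

lemma length_centers_le:
  assumes "G \<in> large_girth"
  shows "length (centers G Q) \<le> card (verts G) div quota G"
proof -
  note G = large_girthD[OF assms]
  note c = centers[OF G(1), where Q = Q]
  let ?M = "set (centers G Q)"
  have "card ?M * quota G = (\<Sum>x\<in>?M. quota G)" by simp
  also have "\<dots> \<le> (\<Sum>x\<in>?M. card (ends G Q x))"
  proof (rule sum_mono)
    fix x assume "x \<in> ?M"
    have "inj_on last (traced G x (radius G) Q)"
      by (rule inj_on_subset[OF inj_on_last_paths_from[OF G(3), of x]]) (auto simp: traced_def)
    then have "card (ends G Q x) = card (traced G x (radius G) Q)"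
      unfolding ends_def by (rule card_image)
    with c(3)[OF \<open>x \<in> ?M\<close>] show "quota G \<le> card (ends G Q x)" by (simp add: crowded_def)
  qed
  also have "\<dots> = card (\<Union>x\<in>?M. ends G Q x)"
    using c(2) by (intro card_UN_disjoint[symmetric])
      (auto simp: disjoint_family_on_def ends_def finite_traced[OF G(1)])
  also have "\<dots> \<le> card (verts G)"
    by (rule card_mono[OF inputsD(5)[OF G(1)]])
      (auto simp: ends_def traced_def paths_from_def walk_def)
  finally have "card ?M \<le> card (verts G) div quota G"
    using quota_pos[OF G(1)] by (simp add: less_eq_div_iff_mult_less_eq)
  then show ?thesis using c(4) by (simp add: distinct_card)
qed

lemma crowded_near_center:
  assumes "ends G Q x \<inter> ends G Q c \<noteq> {}"
  shows "hop_dist G c x \<le> enat (2 * radius G)"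
proof -
  obtain p q where p: "p \<in> paths_from G x (radius G)" and q: "q \<in> paths_from G c (radius G)"
    and eq: "last p = last q"
    using assms by (auto simp: ends_def traced_def)
  have "hop_dist G (last q) x \<le> enat (radius G)"
    using hop_dist_last_le[OF p] unfolding eq hop_dist_commute[of G x] .
  from hop_dist_triangle[OF hop_dist_last_le[OF q] this] show ?thesis by (simp add: mult_2)
qed

lemma code:
  assumes G: "G \<in> inputs" and p: "p \<in> paths_from G x l"
  shows "decode G (code G p) = {last (butlast p), last p}"
    "{last (butlast p), last p} \<in> edges G" "code G p < card (verts G) ^ 2"
proof -
  let ?n = "card (verts G)"
  have "p \<noteq> []" using p by (auto simp: paths_from_def)
  moreover define q b where "q = butlast p" "b = last p"
  ultimately have pq: "p = q @ [b]" by simp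
  with p have "q \<noteq> []" by (auto simp: paths_from_def)
  then show e: "{last (butlast p), last p} \<in> edges G"
    using p by (simp add: pq paths_from_def walk_append)
  then have "last (butlast p) < ?n" "last p < ?n"
    using simple_graph_edgeD[OF inputsD(1)[OF G]] inputs_verts_iff[OF G] by blast+
  then show "decode G (code G p) = {last (butlast p), last p}"
    by (simp add: decode_def code_def)
  have "code G p < (last (butlast p) + 1) * ?n" using \<open>last p < ?n\<close> by (simp add: code_def)
  also have "\<dots> \<le> ?n * ?n" using \<open>last (butlast p) < ?n\<close> by (intro mult_right_mono) auto
  finally show "code G p < ?n ^ 2" by (simp add: power2_eq_square)
qed

section \<open>Soundness and completeness of the learned edges\<close>

lemma codes_sound:
  assumes G: "G \<in> inputs" and w: "w \<in> codes G x"
  shows "decode G w \<in> edges G"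
proof -
  have "\<exists>c l Q. \<exists>p\<in>traced G c l Q. w = code G p"
  proof -
    from w consider y where "edge_hint G y x = Suc w" | z where "w \<in> set (collected G z)"
      unfolding codes_def by blast
    then show ?thesis
    proof cases
      case 1
      let ?T = "traced G x (radius G) (fst (tellers G ! y))"
      from 1 obtain j where j: "j < length (list_of ?T)" "w = code G (list_of ?T ! j)"
        by (auto simp: edge_hint_def Let_def split: if_splits)
      then have "list_of ?T ! j \<in> ?T" using list_of(1)[OF finite_traced[OF G]] nth_mem by blast
      with j(2) show ?thesis by blast
    next
      case 2
      obtain Q' Q i where "collectors G ! z = (Q', Q, i)" by (cases "collectors G ! z")
      with 2 have "w \<in> code G ` set (list_of (traced G (centers G Q ! i) (3 * radius G) Q'))"
        by (auto simp: collected_def split: if_splits)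
      then show ?thesis unfolding list_of(1)[OF finite_traced[OF G]] by blast
    qed
  qed
  then obtain c l Q p where "p \<in> paths_from G c l" "w = code G p" by (auto simp: traced_def)
  with code[OF G this(1)] show ?thesis by simp
qed

text \<open>The edge ends a path \<open>p\<close> from \<open>x\<close>. If \<open>x\<close> is not
  crowded for the trace of \<open>p\<close>, a teller transmits that edge. Otherwise
  \<open>x\<close> is at distance at most \<open>2 * radius G\<close> from some center, and the edge
  also ends a path of at most \<open>3 * radius G\<close> edges from there, which one of the
  requested collectors has.\<close>

lemma codes_complete:
  assumes "G \<in> large_girth" and x: "x \<in> verts G" and e: "e \<in> edges (nbhd G (radius G) x)"
  shows "e \<in> decode G ` codes G x"
proof -
  note G = large_girthD[OF assms(1)]
  have l: "enat m < girth G" if "m \<le> 3 * radius G" for m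
  proof -
    have "m \<le> 2 * (3 * radius G)" using that by simp
    then show ?thesis using G(2) by (meson enat_ord_simps(1) le_less_trans)
  qed
  obtain p where p: "p \<in> paths_from G x (radius G)" "e = {last (butlast p), last p}"
    using edge_of_nbhd_is_last_edge[OF inputsD(1)[OF G(1)] e l] by auto
  have r: "0 < radius G" using p(1) by (auto simp: paths_from_def)
  define Q where "Q = trace G p"
  have Q: "Q \<in> family G (radius G)"
    unfolding Q_def using p(1) r by (intro trace_in_family[OF G(1)]) (auto simp: paths_from_def)
  have pQ: "p \<in> traced G x (radius G) Q" using p(1) by (simp add: traced_def Q_def)
  note lo = list_of[OF finite_traced[OF G(1)]]
  show ?thesis
  proof (cases "crowded G Q x")
    case False
    from pQ obtain j where j: "j < length (list_of (traced G x (radius G) Q))"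
        "list_of (traced G x (radius G) Q) ! j = p"
      using lo(1) by (metis in_set_conv_nth)
    then have "(Q, j) \<in> set (tellers G)"
      using False Q lo(3) by (simp add: tellers crowded_def)
    then obtain y where "y \<in> verts G" "y < length (tellers G)" "tellers G ! y = (Q, j)"
      using nth_role[OF length_roles_le(1)[OF G(1)] G(1)] by blast
    with j have "edge_hint G y x = Suc (code G p)" by (simp add: edge_hint_def)
    with \<open>y \<in> verts G\<close> have "code G p \<in> codes G x" by (auto simp: codes_def)
    then show ?thesis using code(1)[OF G(1) p(1)] p(2) by (metis imageI)
  next
    case True
    \<comment> \<open>Every teller of \<open>Q\<close> notices the crowding; index \<open>0\<close>
      exists because the quota is positive.\<close>
    have "(Q, 0) \<in> set (tellers G)" using Q quota_pos[OF G(1)] by (simp add: tellers)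
    then obtain y where "y \<in> verts G" "y < length (tellers G)" "tellers G ! y = (Q, 0)"
      using nth_role[OF length_roles_le(1)[OF G(1)] G(1)] by blast
    with True have ex: "\<exists>y. y \<in> verts G \<and> 0 < center_hint G y x"
      by (intro exI[of _ y]) (simp add: center_hint_def)
    \<comment> \<open>This teller may belong to a set other than \<open>Q\<close>. Its center does
      as well, since the ball around it contains all of the neighborhood of
      \<open>x\<close>.\<close>
    define y0 where "y0 = (LEAST y. y \<in> verts G \<and> 0 < center_hint G y x)"
    have y0: "y0 \<in> verts G" "0 < center_hint G y0 x"
      unfolding y0_def using LeastI_ex[OF ex] by auto
    define Q0 where "Q0 = fst (tellers G ! y0)"
    have y0': "y0 < length (tellers G)" "crowded G Q0 x"
      using y0(2) by (auto simp: center_hint_def Q0_def split: if_splits)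
    have Q0: "Q0 \<in> family G (radius G)"
      using nth_mem[OF y0'(1)] unfolding tellers Q0_def by (simp add: mem_Times_iff)
    let ?I = "\<lambda>i. i < length (centers G Q0) \<and> ends G Q0 x \<inter> ends G Q0 (centers G Q0 ! i) \<noteq> {}"
    define i where "i = (LEAST i. ?I i)"
    have "\<exists>i. ?I i" using centers(5)[OF G(1) x y0'(2)] by blast
    then have "?I i" unfolding i_def by (rule LeastI_ex)
    then have i: "i < length (centers G Q0)" "ends G Q0 x \<inter> ends G Q0 (centers G Q0 ! i) \<noteq> {}"
      by auto
    have hint: "center_hint G y0 x = Suc i"
      using y0' by (simp add: center_hint_def Q0_def[symmetric] i_def)
    define c where "c = centers G Q0 ! i"
    have "e \<in> edges (nbhd G (2 * radius G + radius G) c)"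
      using nbhd_edges_mono[OF crowded_near_center[OF i(2)]] e unfolding c_def by blast
    then have "e \<in> edges (nbhd G (3 * radius G) c)" by simp
    from edge_of_nbhd_is_last_edge[OF inputsD(1)[OF G(1)] this l[OF order_refl]]
    obtain q where q: "q \<in> paths_from G c (3 * radius G)" "e = {last (butlast q), last q}" by blast
    have "trace G q \<in> family G (3 * radius G)"
      using q(1) r by (intro trace_in_family[OF G(1)]) (auto simp: paths_from_def)
    moreover have "i < card (verts G) div quota G"
      using i(1) length_centers_le[OF assms(1), of Q0] by simp
    ultimately have "(trace G q, Q0, i) \<in> set (collectors G)" using Q0 by (simp add: collectors)
    then obtain z where z: "z \<in> verts G" "z < length (collectors G)"
        "collectors G ! z = (trace G q, Q0, i)"
      using nth_role[OF length_roles_le(2)[OF G(1)] G(1)] by blast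
    have "requested G x = {z \<in> verts G. z < length (collectors G) \<and> snd (collectors G ! z) = (Q0, i)}"
      unfolding requested_def y0_def[symmetric] Let_def Q0_def[symmetric] hint
      using ex by (subst if_P) auto
    with z have "z \<in> requested G x" by simp
    moreover have "q \<in> traced G c (3 * radius G) (trace G q)" using q(1) by (simp add: traced_def)
    then have "code G q \<in> set (collected G z)"
      using z(2,3) i(1) by (simp add: collected_def lo(1) c_def)
    ultimately have "code G q \<in> codes G x" by (auto simp: codes_def)
    then show ?thesis using code(1)[OF G(1) q(1)] q(2) by (metis imageI)
  qed
qed

lemma answer_correct:
  assumes "G \<in> large_girth" "x \<in> verts G" "r \<le> radius G"
  shows "knows G (answer G x) (nbhd G r x)"
proof -
  note G = large_girthD[OF assms(1)]
  \<comment> \<open>Taking \<open>x\<close> itself as center, the slack \<open>radius G - r\<close>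
    turns monotonicity of neighborhoods into monotonicity in the radius.\<close>
  have "hop_dist G x x \<le> enat (radius G - r)"
    unfolding hop_dist_le_iff using assms(2) by (intro exI[of _ "[x]"]) (simp add: walk_def)
  from nbhd_edges_mono[OF this, of r] assms(3)
  have "edges (nbhd G r x) \<subseteq> edges (nbhd G (radius G) x)" by simp
  then have "edges (nbhd G r x) \<subseteq> decode G ` codes G x"
    using codes_complete[OF assms(1,2)] by blast
  moreover have "decode G ` codes G x \<subseteq> edges G" using codes_sound[OF G(1)] by blast
  ultimately show ?thesis
    unfolding knows_def answer_def subgraph_def by (auto simp: nbhd_def)
qed

section \<open>What the nodes can compute after gathering edges\<close>

lemma centers_cong:
  assumes G: "G \<in> inputs" "G' \<in> inputs" and i: "info G = info G'" and k: "known G y = known G' y"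
    and Q: "Q \<subseteq> assigned G y"
  shows "ends G Q = ends G' Q" "crowded G Q = crowded G' Q" "centers G Q = centers G' Q"
proof -
  note t = traced_cong[OF G i k Q] and ic = info_cong[OF i]
  show e: "ends G Q = ends G' Q" by (simp add: ends_def fun_eq_iff t ic(7))
  show c: "crowded G Q = crowded G' Q" by (simp add: crowded_def fun_eq_iff t ic(7) ic(10))
  show "centers G Q = centers G' Q"
    unfolding centers_def e c info_verts[OF i G] ..
qed

lemma info_code: "info G = info G' \<Longrightarrow> code G = code G'"
  using info_cong(1)[of G G'] by (simp add: code_def fun_eq_iff)

lemma teller_assigned: "y < length (tellers G) \<Longrightarrow> fst (tellers G ! y) \<subseteq> assigned G y"
  by (auto simp: assigned_def)

lemma collector_assigned:
  assumes "y < length (collectors G)" "collectors G ! y = (Q', Q, i)"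
  shows "Q' \<subseteq> assigned G y" "Q \<subseteq> assigned G y"
  using assms by (auto simp: assigned_def)

lemma hint_cong:
  assumes G: "G \<in> inputs" "G' \<in> inputs" and i: "info G = info G'" and k: "known G y = known G' y"
  shows "edge_hint G y = edge_hint G' y" "center_hint G y = center_hint G' y"
    "collected G y = collected G' y"
proof -
  note ic = info_cong[OF i]
  show "edge_hint G y = edge_hint G' y"
  proof (cases "y < length (tellers G)")
    case True
    note traced_cong[OF G i k teller_assigned[OF True]]
    then show ?thesis by (simp add: edge_hint_def Let_def ic info_code[OF i] fun_eq_iff)
  qed (simp add: edge_hint_def ic fun_eq_iff)
  show "center_hint G y = center_hint G' y"
  proof (cases "y < length (tellers G)")
    case True
    note centers_cong[OF G i k teller_assigned[OF True]]
    then show ?thesis by (simp add: center_hint_def ic fun_eq_iff)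
  qed (simp add: center_hint_def ic fun_eq_iff)
  show "collected G y = collected G' y"
  proof (cases "y < length (collectors G)")
    case True
    obtain Q' Q j where c: "collectors G ! y = (Q', Q, j)" by (cases "collectors G ! y")
    note traced_cong[OF G i k collector_assigned(1)[OF True c]]
      centers_cong(3)[OF G i k collector_assigned(2)[OF True c]]
    then show ?thesis using c by (simp add: collected_def ic info_code[OF i])
  qed (simp add: collected_def ic)
qed

lemma learnable_large_girth_factor:
  assumes "\<And>G y G'. G \<in> inputs \<Longrightarrow> G' \<in> inputs \<Longrightarrow> info G = info G' \<Longrightarrow> known G y = known G' y \<Longrightarrow>
    f G y = f G' y"
  shows "learnable large_girth f"
proof (rule learnable_mono)
  show "learnable inputs f"
  proof (rule learnable_factor[OF learnable_pair[OF learnable_info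
        learnable_pair[OF learnable_id learnable_known]]])
    fix G v G' v'
    assume G: "G \<in> inputs" "G' \<in> inputs" and "(info G, v :: nat, known G v) = (info G', v', known G' v')"
    then have "info G = info G'" "known G v = known G' v" "v' = v" by auto
    with assms[OF G] show "f G v = f G' v'" by blast
  qed
qed (simp add: large_girth_def)

text \<open>The requested collectors hold disjoint sets of paths from one common center. By the
  girth these paths have distinct ends, so there are at most \<open>n\<close> of them.\<close>

lemma sum_collected_le:
  assumes "G \<in> large_girth"
  shows "(\<Sum>z\<in>requested G x. length (collected G z)) \<le> card (verts G)"
proof -
  note G = large_girthD[OF assms]
  obtain Q i where Z: "requested G x \<subseteq>
      {z \<in> verts G. z < length (collectors G) \<and> snd (collectors G ! z) = (Q, i)}" (is "_ \<subseteq> ?Z")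
  proof (cases "\<exists>y\<in>verts G. 0 < center_hint G y x")
    case True
    from requested_def[of G x, unfolded Let_def if_P[OF this]] show ?thesis
      by (rule that[OF equalityD1])
  next
    case False
    then have "requested G x = {}" unfolding requested_def by (rule if_not_P)
    with that show ?thesis by simp
  qed
  have finZ: "finite ?Z" using inputsD(5)[OF G(1)] by simp
  have "(\<Sum>z\<in>requested G x. length (collected G z)) \<le> (\<Sum>z\<in>?Z. length (collected G z))"
    using finZ Z by (rule sum_mono2) simp
  also have "\<dots> \<le> card (verts G)"
  proof (cases "i < length (centers G Q)")
    case True
    define c where "c = centers G Q ! i"
    let ?T = "\<lambda>z. traced G c (3 * radius G) (fst (collectors G ! z))"
    have "length (collected G z) = card (?T z)" if "z \<in> ?Z" for z
    proof -
      have z: "z < length (collectors G)" "snd (collectors G ! z) = (Q, i)" using that by auto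
      obtain Q' where Q': "collectors G ! z = (Q', Q, i)"
        using z(2) by (cases "collectors G ! z") simp
      have "collected G z = map (code G) (list_of (?T z))"
        using z(1) True by (simp add: collected_def Q' c_def)
      then show ?thesis using list_of(3)[OF finite_traced[OF G(1)]] by simp
    qed
    then have "(\<Sum>z\<in>?Z. length (collected G z)) = (\<Sum>z\<in>?Z. card (?T z))" by (intro sum.cong) auto
    also have "\<dots> = card (\<Union>z\<in>?Z. ?T z)"
    proof (rule card_UN_disjoint[symmetric, OF finZ])
      show "\<forall>z\<in>?Z. finite (?T z)" using finite_traced[OF G(1)] by blast
      show "\<forall>z\<in>?Z. \<forall>z'\<in>?Z. z \<noteq> z' \<longrightarrow> ?T z \<inter> ?T z' = {}"
      proof (intro ballI impI)
        fix z z' assume z: "z \<in> ?Z" "z' \<in> ?Z" "z \<noteq> z'"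
        then have "collectors G ! z \<noteq> collectors G ! z'"
          using collectors(2) by (simp add: nth_eq_iff_index_eq)
        with z have "fst (collectors G ! z) \<noteq> fst (collectors G ! z')" by (simp add: prod_eq_iff)
        then show "?T z \<inter> ?T z' = {}" by (auto simp: traced_def)
      qed
    qed
    also have "\<dots> \<le> card (paths_from G c (3 * radius G))"
      by (intro card_mono finite_paths_from inputsD(5) G(1)) (auto simp: traced_def)
    also have "\<dots> \<le> card (verts G)"
      by (rule card_paths_from_le[OF inputsD(5)[OF G(1)] G(2)])
    finally show ?thesis .
  next
    case False
    have "collected G z = []" if "z \<in> ?Z" for z
      using that False by (auto simp: collected_def split: prod.splits)
    then show ?thesis by simp
  qed
  finally show ?thesis .
qed

lemma collected_words:
  assumes "G \<in> large_girth"
  shows "length (collected G z) < card (verts G) ^ 2"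
    "\<And>w. w \<in> set (collected G z) \<Longrightarrow> w < card (verts G) ^ 2"
proof -
  note G = large_girthD[OF assms]
  obtain Q' Q i where c: "collectors G ! z = (Q', Q, i)" by (cases "collectors G ! z")
  let ?T = "traced G (centers G Q ! i) (3 * radius G) Q'"
  have col: "collected G z = [] \<or> collected G z = map (code G) (list_of ?T)"
    by (simp add: collected_def c)
  note lo = list_of[OF finite_traced[OF G(1)]]
  have "card ?T \<le> card (paths_from G (centers G Q ! i) (3 * radius G))"
    by (intro card_mono finite_paths_from inputsD(5) G(1)) (auto simp: traced_def)
  also have "\<dots> \<le> card (verts G)"
    by (rule card_paths_from_le[OF inputsD(5)[OF G(1)] G(2)])
  also have "\<dots> < card (verts G) ^ 2" using inputsD(3)[OF G(1)] by (simp add: power2_eq_square)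
  finally have T: "card ?T < card (verts G) ^ 2" .
  then have "0 < card (verts G) ^ 2" by (rule le_less_trans[OF le0])
  with T col lo(3) show "length (collected G z) < card (verts G) ^ 2" by fastforce
  fix w assume "w \<in> set (collected G z)"
  with col lo(1) obtain p where "p \<in> ?T" "w = code G p" by (auto simp del: split_paired_Ex)
  then show "w < card (verts G) ^ 2" using code(3)[OF G(1)] by (auto simp: traced_def)
qed

text \<open>Both kinds of hints take one transpose each. The center hints determine the requests,
  and the lists of the collectors are then fetched.\<close>

lemma learnable_answer: "learnable large_girth answer"
proof -
  have lg: "large_girth \<subseteq> inputs" by (auto simp: large_girth_def)
  have "learnable large_girth edge_hint"
    by (rule learnable_large_girth_factor) (rule hint_cong)
  then have edge: "learnable large_girth (\<lambda>G x y. if y \<in> verts G then edge_hint G y x else 0)"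
  \<comment> \<open>Codes are below \<open>n ^ 2\<close>, but the shift by one can reach
    \<open>n ^ 2\<close>.\<close>
  proof (rule learnable_transpose[where k = 3])
    fix G y x assume "G \<in> large_girth"
    note G = large_girthD(1)[OF this]
    let ?n = "card (verts G)"
    let ?T = "traced G x (radius G) (fst (tellers G ! y))"
    have "edge_hint G y x \<le> ?n ^ 2"
    proof (cases "edge_hint G y x")
      case (Suc w)
      then obtain j where j: "j < length (list_of ?T)" "w = code G (list_of ?T ! j)"
        by (auto simp: edge_hint_def Let_def split: if_splits)
      then have "list_of ?T ! j \<in> ?T" using list_of(1)[OF finite_traced[OF G]] nth_mem by blast
      then have "w < ?n ^ 2" using code(3)[OF G] j(2) by (auto simp: traced_def)
      with Suc show ?thesis by simp
    qed simp
    also have "\<dots> < ?n ^ 3" using inputsD(3)[OF G] by (intro power_strict_increasing) auto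
    finally show "edge_hint G y x < ?n ^ 3" .
  qed
  have "learnable large_girth center_hint"
    by (rule learnable_large_girth_factor) (rule hint_cong)
  then have center: "learnable large_girth (\<lambda>G x y. if y \<in> verts G then center_hint G y x else 0)"
  proof (rule learnable_transpose[where k = 2])
    fix G y x assume lgG: "G \<in> large_girth" and "y \<in> verts G" and x: "x \<in> verts G"
    note G = large_girthD(1)[OF lgG]
    let ?n = "card (verts G)"
    have "center_hint G y x \<le> ?n"
    proof (cases "y < length (tellers G) \<and> crowded G (fst (tellers G ! y)) x")
      case True
      define Q where "Q = fst (tellers G ! y)"
      let ?I = "\<lambda>i. i < length (centers G Q) \<and> ends G Q x \<inter> ends G Q (centers G Q ! i) \<noteq> {}"
      have "\<exists>i. ?I i" using centers(5)[OF G x] True unfolding Q_def by blast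
      then have "(LEAST i. ?I i) < length (centers G Q)" using LeastI_ex[of ?I] by blast
      moreover have "center_hint G y x = Suc (LEAST i. ?I i)"
        using True by (simp add: center_hint_def Let_def Q_def)
      moreover have "length (centers G Q) \<le> ?n"
        using length_centers_le[OF lgG, of Q] div_le_dividend le_trans by blast
      ultimately show ?thesis by linarith
    next
      case False
      then show ?thesis unfolding center_hint_def by (simp only: if_False)
    qed
    also have "\<dots> < ?n ^ 2" using inputsD(3)[OF G] by (simp add: power2_eq_square)
    finally show "center_hint G y x < ?n ^ 2" .
  qed
  note info = learnable_mono[OF learnable_info lg]
  have req: "learnable large_girth requested"
  proof (rule learnable_factor[OF learnable_pair[OF info center]])
    fix G x G' x'
    assume "G \<in> large_girth" "G' \<in> large_girth"
    then have G: "G \<in> inputs" "G' \<in> inputs" using lg by auto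
    assume "(info G, \<lambda>y. if y \<in> verts G then center_hint G y x else 0)
      = (info G', \<lambda>y. if y \<in> verts G' then center_hint G' y x' else 0)"
    then have i: "info G = info G'"
      and h: "(\<lambda>y. if y \<in> verts G then center_hint G y x else 0)
        = (\<lambda>y. if y \<in> verts G' then center_hint G' y x' else 0)"
      by simp_all
    have V: "verts G = verts G'" by (rule info_verts[OF i G])
    have c: "center_hint G y x = center_hint G' y x'" if "y \<in> verts G'" for y
      using fun_cong[OF h, of y] that V by simp
    have L: "(LEAST y. y \<in> verts G' \<and> 0 < center_hint G y x) = (LEAST y. y \<in> verts G' \<and> 0 < center_hint G' y x')"
      by (intro arg_cong[where f = Least] ext) (use c in auto)
    have "center_hint G (LEAST y. y \<in> verts G' \<and> 0 < center_hint G' y x') x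
        = center_hint G' (LEAST y. y \<in> verts G' \<and> 0 < center_hint G' y x') x'"
      if "\<exists>y\<in>verts G'. 0 < center_hint G' y x'"
      using LeastI_ex[of "\<lambda>y. y \<in> verts G' \<and> 0 < center_hint G' y x'"] that by (intro c) blast
    moreover have "(\<exists>y\<in>verts G'. 0 < center_hint G y x) \<longleftrightarrow> (\<exists>y\<in>verts G'. 0 < center_hint G' y x')"
      using c by auto
    ultimately show "requested G x = requested G' x'"
      unfolding requested_def V L Let_def info_cong(11,12)[OF i] by simp
  qed
  have "learnable large_girth (\<lambda>G x z. if z \<in> requested G x then collected G z else [])"
  proof (rule learnable_fetch[OF lg _ req, where k = 2 and C = 1])
    show "learnable large_girth collected"
      by (rule learnable_large_girth_factor) (rule hint_cong)
    fix G and x :: nat assume G: "G \<in> large_girth"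
    show "length (collected G x) < card (verts G) ^ 2" by (rule collected_words[OF G])
    show "w < card (verts G) ^ 2" if "w \<in> set (collected G x)" for w
      using that by (rule collected_words[OF G])
    show "requested G x \<subseteq> verts G" unfolding requested_def Let_def by auto
    show "(\<Sum>z\<in>requested G x. length (collected G z)) \<le> 1 * card (verts G)"
      using sum_collected_le[OF G] by simp
  qed
  from learnable_pair[OF learnable_local learnable_pair[OF edge this]] show ?thesis
  proof (rule learnable_map[where h = "\<lambda>((n, _), E, F). Known_Subgraph \<lparr>verts = {..<n},
      edges = (\<lambda>w. {w div n, w mod n}) ` ({w. \<exists>y. E y = Suc w} \<union> (\<Union>z. set (F z)))\<rparr>"])
    fix G x assume "G \<in> large_girth"
    then have G: "G \<in> inputs" using lg by auto
    have "{w. \<exists>y. (if y \<in> verts G then edge_hint G y x else 0) = Suc w}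
        \<union> (\<Union>z. set (if z \<in> requested G x then collected G z else [])) = codes G x"
      unfolding codes_def by (auto split: if_splits)
    then show "answer G x = (\<lambda>((n, _), E, F). Known_Subgraph \<lparr>verts = {..<n},
        edges = (\<lambda>w. {w div n, w mod n}) ` ({w. \<exists>y. E y = Suc w} \<union> (\<Union>z. set (F z)))\<rparr>)
      ((card (verts G), x, {e \<in> edges G. x \<in> e}),
       \<lambda>y. if y \<in> verts G then edge_hint G y x else 0,
       \<lambda>z. if z \<in> requested G x then collected G z else [])"
      by (simp add: answer_def decode_def[abs_def] inputsD(2)[OF G, symmetric])
  qed
qed

section \<open>The computed radius suffices, and the conclusion\<close>

lemma le_radius:
  assumes G: "G \<in> inputs" and g: "girth G = enat g"
  shows "g div 20 \<le> radius G"
proof -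
  obtain c where c: "cycle G c" "length c = g" using girth_attained[OF g] by blast
  then have "3 \<le> g" by (auto simp: cycle_def)
  \<comment> \<open>This is the girth condition behind the Moore bound; for \<open>g < 20\<close> it
    holds because \<open>g\<close> is positive.\<close>
  then have "18 * (g div 20) < g" by linarith
  then have "enat (18 * (g div 20)) < girth G" by (simp add: g)
  note threshold_power_le[OF inputsD(1)[OF G] inputsD(4)[OF G] this]
  then have "feasible (card (verts G)) (threshold G) (g div 20)"
    using inputsD(4)[OF G] by (intro feasibleI)
  moreover have "g div 20 \<le> card (verts G)"
    using cycle_length_le[OF c(1) inputsD(5)[OF G]] c(2) by linarith
  ultimately show ?thesis by (intro radius_max)
qed

theorem theorem11:
  shows "\<exists>(A :: girth_result protocol) (c :: nat) (R :: nat).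
    bandwidth c A \<and>
    (\<forall>(n :: nat) (G :: nat graph) (g :: nat).
       simple_graph G \<and> verts G = {..<n} \<and> girth G = enat g \<and> real g < log 2 (real n) \<longrightarrow>
       (\<forall>v\<in>verts G. result_after A R G v = Girth_Is g) \<or>
       (\<forall>v\<in>verts G. knows G (result_after A R G v) (nbhd G (g div 20) v)))"
proof -
  obtain f' where f': "learnable UNIV f'" "\<And>G v. G \<in> large_girth \<Longrightarrow> v \<in> verts G \<Longrightarrow> f' G v = answer G v"
    using learnable_extend[OF learnable_answer] by blast
  have "learnable inputs (\<lambda>G v. (detected G, f' G v))"
    by (rule learnable_pair[OF learnable_detected learnable_mono[OF f'(1) subset_UNIV]])
  \<comment> \<open>All nodes know the same set \<open>detected G\<close> and therefore take the
    same branch.\<close>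
  then have "learnable inputs (\<lambda>G v. if detected G \<noteq> {} then Girth_Is (Min (detected G)) else f' G v)"
    by (rule learnable_map[where h = "\<lambda>(D, r). if D \<noteq> {} then Girth_Is (Min D) else r"]) simp
  then obtain A c R where A: "bandwidth c A" and res: "\<And>G v. G \<in> inputs \<Longrightarrow> v \<in> verts G \<Longrightarrow>
      result_after A R G v = (if detected G \<noteq> {} then Girth_Is (Min (detected G)) else f' G v)"
    unfolding learnable_def by blast
  have "(\<forall>v\<in>verts G. result_after A R G v = Girth_Is g) \<or>
      (\<forall>v\<in>verts G. knows G (result_after A R G v) (nbhd G (g div 20) v))"
    if G: "simple_graph G" "verts G = {..<n}" "girth G = enat g" "real g < log 2 (real n)" for n G g
  proof -
    \<comment> \<open>For \<open>n \<le> 1\<close> the logarithm is \<open>0\<close>, which no girth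
      is below.\<close>
    have "1 < n"
    proof (rule ccontr)
      assume "\<not> 1 < n"
      then have "n = 0 \<or> n = 1" by auto
      then show False using G(4) by (auto simp: log_def)
    qed
    then have inp: "G \<in> inputs" using G(1,2) by (simp add: inputs_def)
    show ?thesis
    proof (cases "g \<le> 6 * radius G")
      case True
      with detected_girth[OF inp G(3)] res[OF inp] show ?thesis by simp
    next
      case False
      then have "G \<in> large_girth" using inp G(3) by (simp add: large_girth_def)
      moreover have "detected G = {}" using detected_girth[OF inp G(3)] False by simp
      ultimately show ?thesis
        using res[OF inp] f'(2) answer_correct le_radius[OF inp G(3)] by simp
    qed
  qed
  with A show ?thesis by blast
qed

end
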